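(* Let $(\mathcal{C},\mathbb{E},\mathfrak{s})$ be a skeletally small extriangulated category. Let $\mathcal{X}\subseteq\mathcal{C}$ be a full additive subcategory (closed under isomorphisms) which is extension-closed in $(\mathcal{C},\mathbb{E},\mathfrak{s})$ and closed under taking cocones of $\mathfrak{s}$-deflations, i.e. whenever $A\to B\to C$ is an $\mathfrak{s}$-conflation with $B,C\in\mathcal{X}$, then $A\in\mathcal{X}$. If every object $C\in\mathcal{C}$ admits a finite $\mathcal{X}$-resolution, then there is an isomorphism of abelian groups $$K_0(\mathcal{C},\mathbb{E},\mathfrak{s})\xrightarrow{\ \cong\ }K_0(\mathcal{X},\mathbb{E}|_{\mathcal{X}},\mathfrak{s}|_{\mathcal{X}}),\qquad [C]\longmapsto\sum_{i=0}^{n}(-1)^i[X_i],$$ where $X_n\to\cdots\to X_1\to X_0\to C$ is a finite $\mathcal{X}$-resolution of $C$, and its inverse is given by $[X]\mapsto[X]$ for $X\in\mathcal{X}$.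
   Context: Extriangulated category (Nakaoka--Palu): a triple $(\mathcal{C},\mathbb{E},\mathfrak{s})$ with $\mathcal{C}$ an additive category, $\mathbb{E}\colon\mathcal{C}^{\mathrm{op}}\times\mathcal{C}\to\mathrm{Ab}$ a biadditive functor (write $a_*\delta=\mathbb{E}(C,a)(\delta)$, $c^*\delta=\mathbb{E}(c,A)(\delta)$), and $\mathfrak{s}$ assigning to each $\delta\in\mathbb{E}(C,A)$ an equivalence class $\mathfrak{s}(\delta)=[A\xrightarrow{f}B\xrightarrow{g}C]$ (two sequences $A\xrightarrow{f}B\xrightarrow{g}C$ and $A\xrightarrow{f'}B'\xrightarrow{g'}C$ are equivalent if there is an isomorphism $b\colon B\to B'$ with $f'=bf$, $g=g'b$), such that: (i) if $\mathfrak{s}(\delta)=[A\xrightarrow{f}B\xrightarrow{g}C]$, $\mathfrak{s}(\delta')=[A'\xrightarrow{f'}B'\xrightarrow{g'}C']$ and $a\colon A\to A'$, $c\colon C\to C'$ satisfy $a_*\delta=c^*\delta'$, then there is $b\colon B\to B'$ with $bf=f'a$ and $g'b=cg$; (ii) $\mathfrak{s}(0)=[A\to A\oplus C\to C]$ and $\mathfrak{s}(\delta\oplus\delta')=\mathfrak{s}(\delta)\oplus\mathfrak{s}(\delta')$; (ET3) with $\delta,\delta'$ realized as in (i), if $bf=f'a$ then there is $c\colon C\to C'$ with $cg=g'b$ and $a_*\delta=c^*\delta'$; (ET3$^{\mathrm{op}}$) the dual; (ET4) if $\mathfrak{s}(\delta)=[A\xrightarrow{f}B\xrightarrow{f'}D]$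 and $\mathfrak{s}(\delta')=[B\xrightarrow{g}C\xrightarrow{g'}F]$, then there are an object $E$, morphisms $h'\colon C\to E$, $d\colon D\to E$, $e\colon E\to F$ with $h'g=df'$, $eh'=g'$, and $\delta''\in\mathbb{E}(E,A)$ with $\mathfrak{s}(\delta'')=[A\xrightarrow{gf}C\xrightarrow{h'}E]$, $\mathfrak{s}(f'_*\delta')=[D\xrightarrow{d}E\xrightarrow{e}F]$, $d^*\delta''=\delta$ and $f_*\delta''=e^*\delta'$; (ET4$^{\mathrm{op}}$) the dual. If $\mathfrak{s}(\delta)=[A\xrightarrow{f}B\xrightarrow{g}C]$, then $A\xrightarrow{f}B\xrightarrow{g}C$ is called an $\mathfrak{s}$-conflation, $f$ an $\mathfrak{s}$-inflation, $g$ an $\mathfrak{s}$-deflation, and $A$ a cocone of $g$. A subcategory $\mathcal{X}$ is extension-closed if it is additive, closed under isomorphisms, and for each $\mathfrak{s}$-conflation $A\to B\to C$ with $A,C\in\mathcal{X}$ one has $B\in\mathcal{X}$. Then $(\mathcal{X},\mathbb{E}|_{\mathcal{X}},\mathfrak{s}|_{\mathcal{X}})$, with $\mathbb{E}|_{\mathcal{X}}$ the restriction of $\mathbb{E}$ to $\mathcal{X}^{\mathrm{op}}\times\mathcal{X}$ and $\mathfrak{s}|_{\mathcal{X}}$ the restriction of $\mathfrak{s}$, is again extriangulated. Grothendieck group: $K_0(\mathcal{C},\mathbb{E},\mathfrak{s})$ is the abelian group generated by isomorphism classes $[A]$ of objects of $\mathcal{C}$, modulo the relations $[A]-[B]+[C]$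 for every $\mathfrak{s}$-conflation $A\to B\to C$ (these include the split exact sequences). A finite $\mathcal{X}$-resolution (of length $n\ge 0$) of $C\in\mathcal{C}$ is a complex $X_n\xrightarrow{f_{n-1}}X_{n-1}\to\cdots\xrightarrow{f_1g_2}X_1\xrightarrow{f_0g_1}X_0\xrightarrow{g_0}C$ with all $X_i\in\mathcal{X}$, where $C_{i+1}\xrightarrow{f_i}X_i\xrightarrow{g_i}C_i$ is an $\mathfrak{s}$-conflation for each $0\le i\le n-1$, with $C_0=C$ and $C_n=X_n$ (an object $X\in\mathcal{X}$ has a resolution of length $0$). *)

theory Defs
  imports "HOL-Algebra.Free_Abelian_Groups"
begin

section \<open>Additive categories\<close>

text \<open>
  The objects of a category form a set, so every category here is small; this is how skeletal
  smallness is rendered.  Only the values of the structure maps on members of \<open>obj\<close> and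
  of the hom-groups between them matter.  Membership in a hom-group supplies source and target;
  distinct hom-groups need not be disjoint.
  Abelian groups (hom-groups, extension groups, Grothendieck groups) are written
  multiplicatively, as in HOL-Algebra: \<open>\<otimes>\<close> is their addition and
  \<open>\<one>\<close> is their zero.
\<close>

record ('o, 'm) preadditive_data =
  obj :: "'o set"
  hom_group :: "'o \<Rightarrow> 'o \<Rightarrow> 'm monoid"
  ident :: "'o \<Rightarrow> 'm"
  comp_arr :: "'m \<Rightarrow> 'm \<Rightarrow> 'm" (infixl \<open>\<cdot>\<index>\<close> 75)

definition Hom :: "('o, 'm, 'z) preadditive_data_scheme \<Rightarrow> 'o \<Rightarrow> 'o \<Rightarrow> 'm set" where
  "Hom C A B = carrier (hom_group C A B)"

locale category =
  fixes C :: "('o, 'm, 'z) preadditive_data_scheme" (structure)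
  assumes ident_in_Hom: "A \<in> obj C \<Longrightarrow> ident C A \<in> Hom C A A"
    and comp_in_Hom: "\<lbrakk>A \<in> obj C; B \<in> obj C; D \<in> obj C; f \<in> Hom C A B; g \<in> Hom C B D\<rbrakk>
      \<Longrightarrow> g \<cdot> f \<in> Hom C A D"
    and comp_assoc: "\<lbrakk>A \<in> obj C; B \<in> obj C; D \<in> obj C; E \<in> obj C;
        f \<in> Hom C A B; g \<in> Hom C B D; h \<in> Hom C D E\<rbrakk>
      \<Longrightarrow> (h \<cdot> g) \<cdot> f = h \<cdot> (g \<cdot> f)"
    and comp_ident_right: "\<lbrakk>A \<in> obj C; B \<in> obj C; f \<in> Hom C A B\<rbrakk> \<Longrightarrow> f \<cdot> ident C A = f"
    and comp_ident_left: "\<lbrakk>A \<in> obj C; B \<in> obj C; f \<in> Hom C A B\<rbrakk> \<Longrightarrow> ident C B \<cdot> f = f"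

locale preadditive_category = category +
  assumes comm_group_hom_group:
      "\<lbrakk>A \<in> obj C; B \<in> obj C\<rbrakk> \<Longrightarrow> comm_group (hom_group C A B)"
    and comp_add_right: "\<lbrakk>A \<in> obj C; B \<in> obj C; D \<in> obj C;
        f \<in> Hom C A B; f' \<in> Hom C A B; g \<in> Hom C B D\<rbrakk>
      \<Longrightarrow> g \<cdot> (f \<otimes>\<^bsub>hom_group C A B\<^esub> f') = (g \<cdot> f) \<otimes>\<^bsub>hom_group C A D\<^esub> (g \<cdot> f')"
    and comp_add_left: "\<lbrakk>A \<in> obj C; B \<in> obj C; D \<in> obj C;
        f \<in> Hom C A B; g \<in> Hom C B D; g' \<in> Hom C B D\<rbrakk>
      \<Longrightarrow> (g \<otimes>\<^bsub>hom_group C B D\<^esub> g') \<cdot> f = (g \<cdot> f) \<otimes>\<^bsub>hom_group C A D\<^esub> (g' \<cdot> f)"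

definition zero_object :: "('o, 'm, 'z) preadditive_data_scheme \<Rightarrow> 'o \<Rightarrow> bool" where
  "zero_object C Z \<longleftrightarrow> Z \<in> obj C \<and>
     (\<forall>A\<in>obj C. (\<exists>!f. f \<in> Hom C A Z) \<and> (\<exists>!f. f \<in> Hom C Z A))"

definition biproduct ::
  "('o, 'm, 'z) preadditive_data_scheme \<Rightarrow> 'o \<Rightarrow> 'o \<Rightarrow> 'o \<Rightarrow> 'm \<Rightarrow> 'm \<Rightarrow> 'm \<Rightarrow> 'm \<Rightarrow> bool"
  where
  \<comment> \<open>\<open>S\<close> is a biproduct of \<open>A\<close> and \<open>B\<close> with injections
      \<open>i\<close>, \<open>j\<close> and projections \<open>p\<close>, \<open>q\<close>\<close>
  "biproduct C A B S i j p q \<longleftrightarrow>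
     A \<in> obj C \<and> B \<in> obj C \<and> S \<in> obj C \<and>
     i \<in> Hom C A S \<and> j \<in> Hom C B S \<and> p \<in> Hom C S A \<and> q \<in> Hom C S B \<and>
     p \<cdot>\<^bsub>C\<^esub> i = ident C A \<and> q \<cdot>\<^bsub>C\<^esub> j = ident C B \<and>
     q \<cdot>\<^bsub>C\<^esub> i = \<one>\<^bsub>hom_group C A B\<^esub> \<and> p \<cdot>\<^bsub>C\<^esub> j = \<one>\<^bsub>hom_group C B A\<^esub> \<and>
     (i \<cdot>\<^bsub>C\<^esub> p) \<otimes>\<^bsub>hom_group C S S\<^esub> (j \<cdot>\<^bsub>C\<^esub> q) = ident C S"

locale additive_category = preadditive_category +
  assumes zero_object_exists: "\<exists>Z. zero_object C Z"
    and biproduct_exists: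
      "\<lbrakk>A \<in> obj C; B \<in> obj C\<rbrakk> \<Longrightarrow> \<exists>S i j p q. biproduct C A B S i j p q"

definition iso_arr :: "('o, 'm, 'z) preadditive_data_scheme \<Rightarrow> 'o \<Rightarrow> 'o \<Rightarrow> 'm \<Rightarrow> bool" where
  "iso_arr C A B f \<longleftrightarrow> f \<in> Hom C A B \<and>
     (\<exists>g\<in>Hom C B A. g \<cdot>\<^bsub>C\<^esub> f = ident C A \<and> f \<cdot>\<^bsub>C\<^esub> g = ident C B)"

definition iso_rel :: "('o, 'm, 'z) preadditive_data_scheme \<Rightarrow> ('o \<times> 'o) set" where
  "iso_rel C = {(A, B). A \<in> obj C \<and> B \<in> obj C \<and> (\<exists>f. iso_arr C A B f)}"


section \<open>Extriangulated categories\<close>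

text \<open>
  \<open>ext_group T C A\<close> is $\mathbb{E}(C,A)$ and \<open>ext_map T c a\<close> is
  $\mathbb{E}(c,a)$.  A sequence $A \to B \to C$ with fixed ends is stored as the triple of its
  middle object and its two arrows, and \<open>realization T C A \<delta>\<close> is the class
  $\mathfrak{s}(\delta)$ of such triples; the indices \<open>C\<close>, \<open>A\<close> are needed because
  distinct extension groups may overlap as sets.
\<close>

record ('o, 'm, 'e) extri_data = "('o, 'm) preadditive_data" +
  ext_group :: "'o \<Rightarrow> 'o \<Rightarrow> 'e monoid"
  ext_map :: "'m \<Rightarrow> 'm \<Rightarrow> 'e \<Rightarrow> 'e"
  realization :: "'o \<Rightarrow> 'o \<Rightarrow> 'e \<Rightarrow> ('o \<times> 'm \<times> 'm) set"

definition Ext :: "('o, 'm, 'e, 'z) extri_data_scheme \<Rightarrow> 'o \<Rightarrow> 'o \<Rightarrow> 'e set" where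
  "Ext T C A = carrier (ext_group T C A)"

definition push :: "('o, 'm, 'e, 'z) extri_data_scheme \<Rightarrow> 'o \<Rightarrow> 'm \<Rightarrow> 'e \<Rightarrow> 'e" where
  "push T C a \<delta> = ext_map T (ident T C) a \<delta>"

definition pull :: "('o, 'm, 'e, 'z) extri_data_scheme \<Rightarrow> 'm \<Rightarrow> 'o \<Rightarrow> 'e \<Rightarrow> 'e" where
  "pull T c A \<delta> = ext_map T c (ident T A) \<delta>"

definition sequences :: "('o, 'm, 'z) preadditive_data_scheme \<Rightarrow> 'o \<Rightarrow> 'o \<Rightarrow> ('o \<times> 'm \<times> 'm) set"
  where "sequences T A C = {(B, f, g). B \<in> obj T \<and> f \<in> Hom T A B \<and> g \<in> Hom T B C}"

definition seq_rel ::
  "('o, 'm, 'z) preadditive_data_scheme \<Rightarrow> 'o \<Rightarrow> 'o \<Rightarrow> (('o \<times> 'm \<times> 'm) \<times> ('o \<times> 'm \<times> 'm)) set" where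
  "seq_rel T A C = {((B, f, g), (B', f', g')).
     (B, f, g) \<in> sequences T A C \<and> (B', f', g') \<in> sequences T A C \<and>
     (\<exists>b. iso_arr T B B' b \<and> f' = b \<cdot>\<^bsub>T\<^esub> f \<and> g = g' \<cdot>\<^bsub>T\<^esub> b)}"

definition realizes ::
  "('o, 'm, 'e, 'z) extri_data_scheme \<Rightarrow> 'o \<Rightarrow> 'o \<Rightarrow> 'e \<Rightarrow> 'o \<Rightarrow> 'm \<Rightarrow> 'm \<Rightarrow> bool" where
  \<comment> \<open>\<open>\<delta>\<close> is an element of $\mathbb{E}(C,A)$ and
      $\mathfrak{s}(\delta) = [A \to B \to C]$ with arrows \<open>f\<close> and \<open>g\<close>\<close>
  "realizes T C A \<delta> B f g \<longleftrightarrow>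
     A \<in> obj T \<and> C \<in> obj T \<and> \<delta> \<in> Ext T C A \<and> (B, f, g) \<in> sequences T A C \<and>
     realization T C A \<delta> = seq_rel T A C `` {(B, f, g)}"

definition conflation ::
  "('o, 'm, 'e, 'z) extri_data_scheme \<Rightarrow> 'o \<Rightarrow> 'm \<Rightarrow> 'o \<Rightarrow> 'm \<Rightarrow> 'o \<Rightarrow> bool" where
  "conflation T A f B g C \<longleftrightarrow> (\<exists>\<delta>. realizes T C A \<delta> B f g)"

locale biadditive_functor = additive_category T
  for T :: "('o, 'm, 'e, 'z) extri_data_scheme" (structure) +
  assumes comm_group_ext_group:
      "\<lbrakk>C \<in> obj T; A \<in> obj T\<rbrakk> \<Longrightarrow> comm_group (ext_group T C A)"
    and ext_map_hom: "\<lbrakk>C \<in> obj T; C' \<in> obj T; A \<in> obj T; A' \<in> obj T;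
        c \<in> Hom T C' C; a \<in> Hom T A A'\<rbrakk>
      \<Longrightarrow> ext_map T c a \<in> hom (ext_group T C A) (ext_group T C' A')"
    and ext_map_ident: "\<lbrakk>C \<in> obj T; A \<in> obj T; \<delta> \<in> Ext T C A\<rbrakk>
      \<Longrightarrow> ext_map T (ident T C) (ident T A) \<delta> = \<delta>"
    and ext_map_comp: "\<lbrakk>C \<in> obj T; C' \<in> obj T; C'' \<in> obj T;
        A \<in> obj T; A' \<in> obj T; A'' \<in> obj T;
        c \<in> Hom T C' C; c' \<in> Hom T C'' C'; a \<in> Hom T A A'; a' \<in> Hom T A' A'';
        \<delta> \<in> Ext T C A\<rbrakk>
      \<Longrightarrow> ext_map T (c \<cdot> c') (a' \<cdot> a) \<delta> = ext_map T c' a' (ext_map T c a \<delta>)"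
    and ext_map_add_left: "\<lbrakk>C \<in> obj T; C' \<in> obj T; A \<in> obj T; A' \<in> obj T;
        c \<in> Hom T C' C; d \<in> Hom T C' C; a \<in> Hom T A A'; \<delta> \<in> Ext T C A\<rbrakk>
      \<Longrightarrow> ext_map T (c \<otimes>\<^bsub>hom_group T C' C\<^esub> d) a \<delta>
          = ext_map T c a \<delta> \<otimes>\<^bsub>ext_group T C' A'\<^esub> ext_map T d a \<delta>"
    and ext_map_add_right: "\<lbrakk>C \<in> obj T; C' \<in> obj T; A \<in> obj T; A' \<in> obj T;
        c \<in> Hom T C' C; a \<in> Hom T A A'; b \<in> Hom T A A'; \<delta> \<in> Ext T C A\<rbrakk>
      \<Longrightarrow> ext_map T c (a \<otimes>\<^bsub>hom_group T A A'\<^esub> b) \<delta>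
          = ext_map T c a \<delta> \<otimes>\<^bsub>ext_group T C' A'\<^esub> ext_map T c b \<delta>"

text \<open>
  In \<open>realization_sum\<close> the extension $\delta\oplus\delta'$ is the element of
  $\mathbb{E}(C\oplus C', A\oplus A')$ with components $(\delta,0,0,\delta')$ under
  biadditivity, i.e. the sum of the images of $\delta$ and $\delta'$ along the projections of
  $C\oplus C'$ and the injections of $A\oplus A'$.  Both \<open>realization_zero\<close> and
  \<open>realization_sum\<close> are required for every choice of biproducts.
\<close>

locale extriangulated = biadditive_functor +
  assumes realization_class: "\<lbrakk>C \<in> obj T; A \<in> obj T; \<delta> \<in> Ext T C A\<rbrakk>
      \<Longrightarrow> realization T C A \<delta> \<in> sequences T A C // seq_rel T A C"
    and realization_morphism: "\<lbrakk>realizes T C A \<delta> B f g; realizes T C' A' \<delta>' B' f' g';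
        a \<in> Hom T A A'; c \<in> Hom T C C'; push T C a \<delta> = pull T c A' \<delta>'\<rbrakk>
      \<Longrightarrow> \<exists>b\<in>Hom T B B'. b \<cdot> f = f' \<cdot> a \<and> g' \<cdot> b = c \<cdot> g"
    and realization_zero: "biproduct T A C S i j p q
      \<Longrightarrow> realizes T C A \<one>\<^bsub>ext_group T C A\<^esub> S i q"
    and realization_sum: "\<lbrakk>realizes T C A \<delta> B f g; realizes T C' A' \<delta>' B' f' g';
        biproduct T A A' SA iA jA pA qA;
        biproduct T B B' SB iB jB pB qB;
        biproduct T C C' SC iC jC pC qC\<rbrakk>
      \<Longrightarrow> realizes T SC SA
            (ext_map T pC iA \<delta> \<otimes>\<^bsub>ext_group T SC SA\<^esub> ext_map T qC jA \<delta>')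
            SB
            ((iB \<cdot> f \<cdot> pA) \<otimes>\<^bsub>hom_group T SA SB\<^esub> (jB \<cdot> f' \<cdot> qA))
            ((iC \<cdot> g \<cdot> pB) \<otimes>\<^bsub>hom_group T SB SC\<^esub> (jC \<cdot> g' \<cdot> qB))"
    and ET3: "\<lbrakk>realizes T C A \<delta> B f g; realizes T C' A' \<delta>' B' f' g';
        a \<in> Hom T A A'; b \<in> Hom T B B'; b \<cdot> f = f' \<cdot> a\<rbrakk>
      \<Longrightarrow> \<exists>c\<in>Hom T C C'. c \<cdot> g = g' \<cdot> b \<and> push T C a \<delta> = pull T c A' \<delta>'"
    and ET3_op: "\<lbrakk>realizes T C A \<delta> B f g; realizes T C' A' \<delta>' B' f' g';
        b \<in> Hom T B B'; c \<in> Hom T C C'; c \<cdot> g = g' \<cdot> b\<rbrakk>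
      \<Longrightarrow> \<exists>a\<in>Hom T A A'. b \<cdot> f = f' \<cdot> a \<and> push T C a \<delta> = pull T c A' \<delta>'"
    and ET4: "\<lbrakk>realizes T D A \<delta> B f f'; realizes T F B \<delta>' C g g'\<rbrakk>
      \<Longrightarrow> \<exists>E\<in>obj T. \<exists>h'\<in>Hom T C E. \<exists>d\<in>Hom T D E. \<exists>e\<in>Hom T E F. \<exists>\<delta>''\<in>Ext T E A.
            h' \<cdot> g = d \<cdot> f' \<and> e \<cdot> h' = g' \<and>
            realizes T E A \<delta>'' C (g \<cdot> f) h' \<and>
            realizes T F D (push T F f' \<delta>') E d e \<and>
            pull T d A \<delta>'' = \<delta> \<and> push T E f \<delta>'' = pull T e B \<delta>'"
    and ET4_op: "\<lbrakk>realizes T A D \<delta> B f' f; realizes T B F \<delta>' C g' g\<rbrakk>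
      \<Longrightarrow> \<exists>E\<in>obj T. \<exists>h'\<in>Hom T E C. \<exists>d\<in>Hom T E D. \<exists>e\<in>Hom T F E. \<exists>\<delta>''\<in>Ext T A E.
            g \<cdot> h' = f' \<cdot> d \<and> h' \<cdot> e = g' \<and>
            realizes T A E \<delta>'' C h' (f \<cdot> g) \<and>
            realizes T D F (pull T f' F \<delta>') E e d \<and>
            push T A d \<delta>'' = \<delta> \<and> pull T f E \<delta>'' = push T B e \<delta>'"


section \<open>Full subcategories\<close>

definition full_sub ::
  "('o, 'm, 'e, 'z) extri_data_scheme \<Rightarrow> 'o set \<Rightarrow> ('o, 'm, 'e, 'z) extri_data_scheme" where
  "full_sub T \<S> = T\<lparr>obj := \<S>,
     realization := (\<lambda>C A \<delta>. {(B, f, g) \<in> realization T C A \<delta>. B \<in> \<S>})\<rparr>"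

definition extension_closed :: "('o, 'm, 'e, 'z) extri_data_scheme \<Rightarrow> 'o set \<Rightarrow> bool" where
  "extension_closed T \<S> \<longleftrightarrow>
     \<S> \<subseteq> obj T \<and> additive_category (full_sub T \<S>) \<and>
     (\<forall>A B. A \<in> \<S> \<and> (A, B) \<in> iso_rel T \<longrightarrow> B \<in> \<S>) \<and>
     (\<forall>A f B g C. conflation T A f B g C \<and> A \<in> \<S> \<and> C \<in> \<S> \<longrightarrow> B \<in> \<S>)"

definition cocone_closed :: "('o, 'm, 'e, 'z) extri_data_scheme \<Rightarrow> 'o set \<Rightarrow> bool" where
  "cocone_closed T \<S> \<longleftrightarrow>
     (\<forall>A f B g C. conflation T A f B g C \<and> B \<in> \<S> \<and> C \<in> \<S> \<longrightarrow> A \<in> \<S>)"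

text \<open>
  The complex $X_n \to \dots \to X_0 \to A$ has differentials \<open>d i\<close>, where \<open>d 0\<close> is the
  augmentation $X_0 \to A$ and \<open>d i\<close> goes from $X_i$ to $X_{i-1}$.  Putting $g_n = \mathrm{id}$
  makes \<open>d n\<close> equal to $f_{n-1}$ when $n > 0$, and gives the length zero resolution
  $X_0 = A$ with identity augmentation when $n = 0$.  Values at indices above \<open>n\<close> are
  irrelevant.
\<close>

definition finite_resolution ::
  "('o, 'm, 'e, 'z) extri_data_scheme \<Rightarrow> 'o set \<Rightarrow> 'o \<Rightarrow> nat \<Rightarrow> (nat \<Rightarrow> 'o) \<Rightarrow> (nat \<Rightarrow> 'm) \<Rightarrow> bool"
  where
  "finite_resolution T \<S> A n Xs d \<longleftrightarrow>
     (\<forall>i\<le>n. Xs i \<in> \<S>) \<and>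
     (\<exists>Cs f g. Cs 0 = A \<and> Cs n = Xs n \<and> g n = ident T (Xs n) \<and>
        (\<forall>i<n. conflation T (Cs (Suc i)) (f i) (Xs i) (g i) (Cs i)) \<and>
        d 0 = g 0 \<and> (\<forall>i<n. d (Suc i) = f i \<cdot>\<^bsub>T\<^esub> g (Suc i)))"


section \<open>The Grothendieck group\<close>

definition K0_free ::
  "('o, 'm, 'e, 'z) extri_data_scheme \<Rightarrow> ('o set \<Rightarrow>\<^sub>0 int) monoid" where
  "K0_free T = free_Abelian_group (obj T // iso_rel T)"

definition K0_gen :: "('o, 'm, 'e, 'z) extri_data_scheme \<Rightarrow> 'o \<Rightarrow> ('o set \<Rightarrow>\<^sub>0 int)" where
  "K0_gen T A = frag_of (iso_rel T `` {A})"

definition K0_relations :: "('o, 'm, 'e, 'z) extri_data_scheme \<Rightarrow> ('o set \<Rightarrow>\<^sub>0 int) set" where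
  "K0_relations T = generate (K0_free T)
     {K0_gen T A - K0_gen T B + K0_gen T C | A f B g C. conflation T A f B g C}"

definition K0 :: "('o, 'm, 'e, 'z) extri_data_scheme \<Rightarrow> ('o set \<Rightarrow>\<^sub>0 int) set monoid" where
  "K0 T = K0_free T Mod K0_relations T"

definition K0_class ::
  "('o, 'm, 'e, 'z) extri_data_scheme \<Rightarrow> 'o \<Rightarrow> ('o set \<Rightarrow>\<^sub>0 int) set" where
  "K0_class T A = K0_relations T #>\<^bsub>K0_free T\<^esub> K0_gen T A"

lemma comm_group_K0: "comm_group (K0 T)"
proof -
  interpret F: comm_group "K0_free T"
    unfolding K0_free_def by (rule abelian_free_Abelian_group)
  have gen: "Poly_Mapping.keys (K0_gen T A) \<subseteq> obj T // iso_rel T" if "A \<in> obj T" for A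
    using that by (auto simp: K0_gen_def quotient_def)
  have rel: "K0_gen T A - K0_gen T B + K0_gen T C \<in> carrier (K0_free T)"
    if "conflation T A f B g C" for A f B g C
  proof -
    have "A \<in> obj T" "B \<in> obj T" "C \<in> obj T"
      using that by (auto simp: conflation_def realizes_def sequences_def)
    then have "Poly_Mapping.keys (K0_gen T A) \<subseteq> obj T // iso_rel T"
      "Poly_Mapping.keys (K0_gen T B) \<subseteq> obj T // iso_rel T"
      "Poly_Mapping.keys (K0_gen T C) \<subseteq> obj T // iso_rel T"
      using gen by blast+
    then show ?thesis
      using keys_diff[of "K0_gen T A" "K0_gen T B"]
        keys_add[of "K0_gen T A - K0_gen T B" "K0_gen T C"]
      unfolding K0_free_def carrier_free_Abelian_group_iff by blast
  qed
  have "subgroup (K0_relations T) (K0_free T)"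
    unfolding K0_relations_def by (rule F.generate_is_subgroup) (use rel in auto)
  then show ?thesis
    unfolding K0_def by (rule F.abelian_FactGroup)
qed

end

theory Submission
  imports Defs
begin

text \<open>
  The inverse map is induced by the inclusion of the subcategory, so the theorem says that every
  additive function on \<open>\<S>\<close>, with values in an abelian group, extends uniquely to an additive function
  on the whole category.  Uniqueness is clear from resolutions (\<open>additive_unique\<close>), which also dictate
  the value: the alternating sum along a resolution.  What has to be shown is that this Euler
  characteristic is additive on conflations \<open>A \<rightarrow> B \<rightarrow> C\<close>, for any choice of resolutions of the three
  terms (\<open>euler_conflation\<close>).  Independence of the resolution is the special case of the conflations
  attached to isomorphisms.

  The proof is by induction on the length of the resolutions.  Let \<open>XB \<rightarrow> B\<close> and \<open>XC \<rightarrow> C\<close> be the first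
  deflations of resolutions of \<open>B\<close> and \<open>C\<close>.  A substitute for the pullback of \<open>XB \<rightarrow> B \<rightarrow> C\<close> and \<open>XC \<rightarrow> C\<close>
  (\<open>pullback_of_deflations\<close>) is covered by a deflation from some \<open>Y\<close> in \<open>\<S>\<close>, and then \<open>Y \<rightarrow> XB\<close> and
  \<open>Y \<rightarrow> XC\<close> are deflations whose cocones lie in \<open>\<S>\<close>, because \<open>\<S>\<close> is closed under cocones.
  The cocones \<open>K\<close> of \<open>Y \<rightarrow> B\<close> and \<open>L\<close> of \<open>Y \<rightarrow> C\<close> are therefore extensions of first syzygies of \<open>B\<close> and
  \<open>C\<close> by objects of \<open>\<S>\<close>, and such extensions are resolved in the same length as the syzygies
  (\<open>euler_extension_by_sub\<close>).  Since \<open>K \<rightarrow> L \<rightarrow> A\<close> is a conflation and the difference of the values at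
  \<open>B\<close> and \<open>C\<close> equals that of \<open>L\<close> and \<open>K\<close>, additivity for \<open>A \<rightarrow> B \<rightarrow> C\<close> reduces to additivity for
  \<open>K \<rightarrow> L \<rightarrow> A\<close> (\<open>syzygy_conflation\<close>).  Here two of the three lengths have dropped; a second such step
  makes all three drop.

  Extriangulated categories need not have kernels or pullbacks, so comparison arrows are not unique.
  Where an abelian category would call for the five lemma, the composite of two
  comparison arrows is seen to be \<open>1 - u\<close> with \<open>u\<^sup>2 = 0\<close>, hence invertible.
\<close>

section \<open>Invertible arrows in preadditive categories\<close>

context preadditive_category
begin

lemma zero_in_Hom: "\<lbrakk>A \<in> obj C; B \<in> obj C\<rbrakk> \<Longrightarrow> \<one>\<^bsub>hom_group C A B\<^esub> \<in> Hom C A B"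
  using comm_group_hom_group[of A B]
  by (simp add: Hom_def comm_group.axioms(2) group.is_monoid monoid.one_closed)

lemma comp_zero_right:
  assumes "A \<in> obj C" "B \<in> obj C" "D \<in> obj C" "g \<in> Hom C B D"
  shows "g \<cdot> \<one>\<^bsub>hom_group C A B\<^esub> = \<one>\<^bsub>hom_group C A D\<^esub>"
proof -
  interpret AB: comm_group "hom_group C A B" using assms comm_group_hom_group by blast
  interpret AD: comm_group "hom_group C A D" using assms comm_group_hom_group by blast
  let ?x = "g \<cdot> \<one>\<^bsub>hom_group C A B\<^esub>"
  have "?x \<in> carrier (hom_group C A D)"
    using comp_in_Hom[OF assms(1-3) zero_in_Hom[OF assms(1,2)] assms(4)] by (simp add: Hom_def)
  moreover have "?x \<otimes>\<^bsub>hom_group C A D\<^esub> ?x = ?x"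
    using comp_add_right[OF assms(1-3) zero_in_Hom[OF assms(1,2)] zero_in_Hom[OF assms(1,2)] assms(4)]
    by simp
  ultimately show ?thesis by (simp add: AD.l_cancel_one)
qed

lemma comp_zero_left:
  assumes "A \<in> obj C" "B \<in> obj C" "D \<in> obj C" "f \<in> Hom C A B"
  shows "\<one>\<^bsub>hom_group C B D\<^esub> \<cdot> f = \<one>\<^bsub>hom_group C A D\<^esub>"
proof -
  interpret BD: comm_group "hom_group C B D" using assms comm_group_hom_group by blast
  interpret AD: comm_group "hom_group C A D" using assms comm_group_hom_group by blast
  let ?x = "\<one>\<^bsub>hom_group C B D\<^esub> \<cdot> f"
  have "?x \<in> carrier (hom_group C A D)"
    using comp_in_Hom[OF assms(1-4) zero_in_Hom[OF assms(2,3)]] by (simp add: Hom_def)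
  moreover have "?x \<otimes>\<^bsub>hom_group C A D\<^esub> ?x = ?x"
    using comp_add_left[OF assms(1-4) zero_in_Hom[OF assms(2,3)] zero_in_Hom[OF assms(2,3)]]
    by simp
  ultimately show ?thesis by (simp add: AD.l_cancel_one)
qed

text \<open>
  The arrow \<open>u\<close> is \<open>1 - w\<close>.  The lemmas below speak of it through its sum with \<open>w\<close>, which
  keeps inverses of the hom-groups out of the calculations with composites.
\<close>

lemma ident_split:
  assumes "M \<in> obj C" "w \<in> Hom C M M"
  obtains u where "u \<in> Hom C M M" "w \<otimes>\<^bsub>hom_group C M M\<^esub> u = ident C M"
proof -
  interpret G: comm_group "hom_group C M M" using assms comm_group_hom_group by blast
  have "w \<in> carrier (hom_group C M M)" "ident C M \<in> carrier (hom_group C M M)"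
    using assms ident_in_Hom by (auto simp: Hom_def)
  then show ?thesis
    using that[of "inv\<^bsub>hom_group C M M\<^esub> w \<otimes>\<^bsub>hom_group C M M\<^esub> ident C M"]
    by (simp add: Hom_def flip: G.m_assoc)
qed

lemma comp_complement_zero_left:
  assumes M: "M \<in> obj C" and N: "N \<in> obj C" and w: "w \<in> Hom C M M" and u: "u \<in> Hom C M M"
    and sum: "w \<otimes>\<^bsub>hom_group C M M\<^esub> u = ident C M" and f: "f \<in> Hom C N M" and fixed: "w \<cdot> f = f"
  shows "u \<cdot> f = \<one>\<^bsub>hom_group C N M\<^esub>"
proof -
  interpret NM: comm_group "hom_group C N M" using assms comm_group_hom_group by blast
  have "f \<otimes>\<^bsub>hom_group C N M\<^esub> (u \<cdot> f) = f"
    using comp_add_left[OF N M M f w u] sum fixed comp_ident_left[OF N M f] by simp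
  then show ?thesis
    using f comp_in_Hom[OF N M M f u] by (simp add: Hom_def NM.l_cancel_one)
qed

lemma comp_complement_zero_right:
  assumes M: "M \<in> obj C" and N: "N \<in> obj C" and w: "w \<in> Hom C M M" and u: "u \<in> Hom C M M"
    and sum: "w \<otimes>\<^bsub>hom_group C M M\<^esub> u = ident C M" and g: "g \<in> Hom C M N" and fixed: "g \<cdot> w = g"
  shows "g \<cdot> u = \<one>\<^bsub>hom_group C M N\<^esub>"
proof -
  interpret MN: comm_group "hom_group C M N" using assms comm_group_hom_group by blast
  have "g \<otimes>\<^bsub>hom_group C M N\<^esub> (g \<cdot> u) = g"
    using comp_add_right[OF M M N w u g] sum fixed comp_ident_right[OF M N g] by simp
  then show ?thesis
    using g comp_in_Hom[OF M M N u g] by (simp add: Hom_def MN.l_cancel_one)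
qed

text \<open>
  From \<open>w = 1 - u\<close> and \<open>u\<^sup>2 = 0\<close> it follows that \<open>1 + u\<close> inverts \<open>w\<close>.  This replaces the five lemma:
  the composite of two opposite comparison arrows between conflations differs from the identity by
  an arrow of square zero.
\<close>

lemma unipotent_invertible:
  assumes M: "M \<in> obj C" and w: "w \<in> Hom C M M" and u: "u \<in> Hom C M M"
    and sum: "w \<otimes>\<^bsub>hom_group C M M\<^esub> u = ident C M" and sq: "u \<cdot> u = \<one>\<^bsub>hom_group C M M\<^esub>"
  shows "\<exists>w'\<in>Hom C M M. w' \<cdot> w = ident C M \<and> w \<cdot> w' = ident C M"
proof -
  interpret G: comm_group "hom_group C M M" using M comm_group_hom_group by blast
  let ?w' = "ident C M \<otimes>\<^bsub>hom_group C M M\<^esub> u"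
  note id = ident_in_Hom[OF M]
  have uw: "u \<cdot> w = u"
    using comp_add_right[OF M M M w u u] sum sq comp_ident_right[OF M M u]
      comp_in_Hom[OF M M M w u] by (simp add: Hom_def)
  have wu: "w \<cdot> u = u"
    using comp_add_left[OF M M M u w u] sum sq comp_ident_left[OF M M u]
      comp_in_Hom[OF M M M u w] by (simp add: Hom_def)
  have "?w' \<cdot> w = ident C M"
    using comp_add_left[OF M M M w id u] uw sum comp_ident_left[OF M M w] by simp
  moreover have "w \<cdot> ?w' = ident C M"
    using comp_add_right[OF M M M id u w] wu sum comp_ident_right[OF M M w] by simp
  moreover have "?w' \<in> Hom C M M" using id u by (simp add: Hom_def)
  ultimately show ?thesis by blast
qed

lemma iso_arr_from_inverses:
  assumes M: "M \<in> obj C" and N: "N \<in> obj C" and b: "b \<in> Hom C M N" and b': "b' \<in> Hom C N M"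
    and x: "x \<in> Hom C M M" "x \<cdot> (b' \<cdot> b) = ident C M"
    and y: "y \<in> Hom C N N" "(b \<cdot> b') \<cdot> y = ident C N"
  shows "iso_arr C M N b"
proof -
  let ?l = "x \<cdot> b'" and ?r = "b' \<cdot> y"
  have l: "?l \<in> Hom C N M" and r: "?r \<in> Hom C N M"
    using comp_in_Hom M N b' x y by blast+
  have lb: "?l \<cdot> b = ident C M" using comp_assoc[OF M N M M b b' x(1)] x by simp
  have br: "b \<cdot> ?r = ident C N" using comp_assoc[OF N N M N y(1) b' b] y by simp
  have "?l = ?l \<cdot> (b \<cdot> ?r)" using br comp_ident_right[OF N M l] by simp
  also have "\<dots> = ?r" using comp_assoc[OF N M N M r b l] lb comp_ident_left[OF N M r] by simp
  finally show ?thesis using lb br b l unfolding iso_arr_def by auto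
qed

lemma iso_arr_inverse:
  assumes "iso_arr C A B a"
  obtains a' where "iso_arr C B A a'" "a' \<cdot> a = ident C A" "a \<cdot> a' = ident C B"
  using assms unfolding iso_arr_def by auto

lemma iso_arr_ident: "A \<in> obj C \<Longrightarrow> iso_arr C A A (ident C A)"
  unfolding iso_arr_def using comp_ident_left ident_in_Hom by blast

lemma iso_arr_comp:
  assumes A: "A \<in> obj C" and B: "B \<in> obj C" and D: "D \<in> obj C"
    and a: "iso_arr C A B a" and b: "iso_arr C B D b"
  shows "iso_arr C A D (b \<cdot> a)"
proof -
  obtain a' where a': "iso_arr C B A a'" "a' \<cdot> a = ident C A" "a \<cdot> a' = ident C B"
    using iso_arr_inverse[OF a] .
  obtain b' where b': "iso_arr C D B b'" "b' \<cdot> b = ident C B" "b \<cdot> b' = ident C D"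
    using iso_arr_inverse[OF b] .
  have h: "a \<in> Hom C A B" "b \<in> Hom C B D" "a' \<in> Hom C B A" "b' \<in> Hom C D B"
    using a b a' b' by (auto simp: iso_arr_def)
  have ba: "b \<cdot> a \<in> Hom C A D" and ab: "a' \<cdot> b' \<in> Hom C D A"
    using comp_in_Hom A B D h by blast+
  have "(a' \<cdot> b') \<cdot> (b \<cdot> a) = a' \<cdot> ((b' \<cdot> b) \<cdot> a)"
    using comp_assoc[OF A D B A ba h(4) h(3)] comp_assoc[OF A B D B h(1,2,4)] by simp
  then have 1: "(a' \<cdot> b') \<cdot> (b \<cdot> a) = ident C A"
    using a' b' comp_ident_left[OF A B h(1)] by simp
  have "(b \<cdot> a) \<cdot> (a' \<cdot> b') = b \<cdot> ((a \<cdot> a') \<cdot> b')"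
    using comp_assoc[OF D A B D ab h(1) h(2)] comp_assoc[OF D B A B h(4,3,1)] by simp
  then have 2: "(b \<cdot> a) \<cdot> (a' \<cdot> b') = ident C D"
    using a' b' comp_ident_left[OF D B h(4)] by simp
  show ?thesis using 1 2 ba ab unfolding iso_arr_def by blast
qed

lemma equiv_iso_rel: "equiv (obj C) (iso_rel C)"
proof (rule equivI)
  show "refl_on (obj C) (iso_rel C)"
    by (rule refl_onI) (auto simp: iso_rel_def intro: iso_arr_ident)
  show "sym (iso_rel C)"
    by (rule symI) (auto simp: iso_rel_def elim: iso_arr_inverse)
  show "trans (iso_rel C)"
    by (rule transI) (auto simp: iso_rel_def intro: iso_arr_comp)
qed (auto simp: iso_rel_def)

lemma zero_object_arr:
  "\<lbrakk>zero_object C Z; A \<in> obj C; f \<in> Hom C A Z; g \<in> Hom C A Z\<rbrakk> \<Longrightarrow> f = g"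
  "\<lbrakk>zero_object C Z; A \<in> obj C; f \<in> Hom C Z A; g \<in> Hom C Z A\<rbrakk> \<Longrightarrow> f = g"
  unfolding zero_object_def by blast+

text \<open>
  Every arrow into or out of \<open>Z\<close> passes through the identity of \<open>Z\<close>, so it vanishes with it.
\<close>

lemma zero_objectI:
  assumes Z: "Z \<in> obj C" and id0: "ident C Z = \<one>\<^bsub>hom_group C Z Z\<^esub>"
  shows "zero_object C Z"
proof -
  have "f = \<one>\<^bsub>hom_group C A Z\<^esub>" if "A \<in> obj C" "f \<in> Hom C A Z" for A f
    using that Z id0 comp_ident_left comp_zero_left by metis
  moreover have "f = \<one>\<^bsub>hom_group C Z A\<^esub>" if "A \<in> obj C" "f \<in> Hom C Z A" for A f
    using that Z id0 comp_ident_right comp_zero_right by metis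
  ultimately show ?thesis
    using Z zero_in_Hom unfolding zero_object_def by metis
qed

lemma biproduct_swap:
  assumes "biproduct C A B S i j p q"
  shows "biproduct C B A S j i q p"
proof -
  have S: "S \<in> obj C" "A \<in> obj C" "B \<in> obj C" using assms by (auto simp: biproduct_def)
  interpret G: comm_group "hom_group C S S" using S comm_group_hom_group by blast
  have "i \<cdot> p \<in> Hom C S S" "j \<cdot> q \<in> Hom C S S"
    using assms S comp_in_Hom unfolding biproduct_def by blast+
  then show ?thesis
    using assms G.m_comm unfolding biproduct_def Hom_def by metis
qed

text \<open>
  An isomorphism \<open>A \<rightarrow> B\<close> exhibits \<open>A\<close> as a biproduct of zero and \<open>B\<close>.  Hence it is a deflation with
  zero cocone, which is how isomorphism invariance follows from additivity.
\<close>

lemma biproduct_zero_left: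
  assumes Z: "zero_object C Z" and A: "A \<in> obj C" and B: "B \<in> obj C" and a: "iso_arr C A B a"
  shows "\<exists>j. biproduct C Z B A \<one>\<^bsub>hom_group C Z A\<^esub> j \<one>\<^bsub>hom_group C A Z\<^esub> a"
proof -
  have Zo: "Z \<in> obj C" using Z by (simp add: zero_object_def)
  interpret G: comm_group "hom_group C A A" using A comm_group_hom_group by blast
  obtain a' where a': "iso_arr C B A a'" "a' \<cdot> a = ident C A" "a \<cdot> a' = ident C B"
    using iso_arr_inverse[OF a] .
  have h: "a \<in> Hom C A B" "a' \<in> Hom C B A" using a a' by (auto simp: iso_arr_def)
  have "ident C A \<in> carrier (hom_group C A A)" using ident_in_Hom[OF A] by (simp add: Hom_def)
  then have "biproduct C Z B A \<one>\<^bsub>hom_group C Z A\<^esub> a' \<one>\<^bsub>hom_group C A Z\<^esub> a"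
    unfolding biproduct_def using Zo A B h a' zero_in_Hom zero_object_arr(1)[OF Z Zo]
    by (auto simp: ident_in_Hom comp_zero_left comp_zero_right)
  then show ?thesis by blast
qed

end

section \<open>Conflations\<close>

context preadditive_category
begin

lemma equiv_seq_rel:
  assumes A: "A \<in> obj C" and D: "D \<in> obj C"
  shows "equiv (sequences C A D) (seq_rel C A D)"
proof (rule equivI)
  show "refl_on (sequences C A D) (seq_rel C A D)"
  proof (rule refl_onI)
    fix x assume x: "x \<in> sequences C A D"
    then obtain B f g where [simp]: "x = (B, f, g)" and *: "B \<in> obj C" "f \<in> Hom C A B" "g \<in> Hom C B D"
      by (auto simp: sequences_def)
    show "(x, x) \<in> seq_rel C A D"
      using x * iso_arr_ident[OF *(1)] comp_ident_left[OF A *(1) *(2)]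
        comp_ident_right[OF *(1) D *(3)] unfolding seq_rel_def
      by auto
  qed
  show "sym (seq_rel C A D)"
  proof (rule symI)
    fix x y assume xy: "(x, y) \<in> seq_rel C A D"
    then obtain B f g B' f' g' b where [simp]: "x = (B, f, g)" "y = (B', f', g')"
      and s: "(B, f, g) \<in> sequences C A D" "(B', f', g') \<in> sequences C A D"
      and b: "iso_arr C B B' b" "f' = b \<cdot> f" "g = g' \<cdot> b" by (auto simp: seq_rel_def)
    have o: "B \<in> obj C" "B' \<in> obj C" "f \<in> Hom C A B" "g' \<in> Hom C B' D" using s by (auto simp: sequences_def)
    obtain b' where b': "iso_arr C B' B b'" "b' \<cdot> b = ident C B" "b \<cdot> b' = ident C B'"
      using iso_arr_inverse[OF b(1)] .
    have h: "b \<in> Hom C B B'" "b' \<in> Hom C B' B" using b b' by (auto simp: iso_arr_def)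
    have "f = b' \<cdot> f'"
      using comp_assoc[OF A o(1,2,1,3) h] b b' comp_ident_left[OF A o(1,3)] by simp
    moreover have "g' = g \<cdot> b'"
      using comp_assoc[OF o(2,1,2) D h(2,1) o(4)] b b' comp_ident_right[OF o(2) D o(4)] by simp
    ultimately show "(y, x) \<in> seq_rel C A D" using s b' unfolding seq_rel_def by auto
  qed
  show "trans (seq_rel C A D)"
  proof (rule transI)
    fix x y z assume xy: "(x, y) \<in> seq_rel C A D" and yz: "(y, z) \<in> seq_rel C A D"
    then obtain B f g B' f' g' B'' f'' g'' b c where
      [simp]: "x = (B, f, g)" "y = (B', f', g')" "z = (B'', f'', g'')"
      and s: "(B, f, g) \<in> sequences C A D" "(B', f', g') \<in> sequences C A D" "(B'', f'', g'') \<in> sequences C A D"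
      and b: "iso_arr C B B' b" "f' = b \<cdot> f" "g = g' \<cdot> b"
      and c: "iso_arr C B' B'' c" "f'' = c \<cdot> f'" "g' = g'' \<cdot> c"
      by (auto simp: seq_rel_def)
    have o: "B \<in> obj C" "B' \<in> obj C" "B'' \<in> obj C" "f \<in> Hom C A B" "g'' \<in> Hom C B'' D"
      using s by (auto simp: sequences_def)
    have h: "b \<in> Hom C B B'" "c \<in> Hom C B' B''" using b c by (auto simp: iso_arr_def)
    have "iso_arr C B B'' (c \<cdot> b)" using iso_arr_comp o b c by blast
    moreover have "f'' = (c \<cdot> b) \<cdot> f" using comp_assoc[OF A o(1,2,3,4) h] b c by simp
    moreover have "g = g'' \<cdot> (c \<cdot> b)" using comp_assoc[OF o(1,2,3) D h o(5)] b c by simp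
    ultimately show "(x, z) \<in> seq_rel C A D" using s unfolding seq_rel_def by auto
  qed
qed (auto simp: seq_rel_def)

end

context extriangulated
begin

lemma realizesD:
  assumes "realizes T C A \<delta> B f g"
  shows "A \<in> obj T" "B \<in> obj T" "C \<in> obj T" "\<delta> \<in> Ext T C A" "f \<in> Hom T A B" "g \<in> Hom T B C"
  using assms by (auto simp: realizes_def sequences_def)

lemma conflationD:
  assumes "conflation T A f B g C"
  shows "A \<in> obj T" "B \<in> obj T" "C \<in> obj T" "f \<in> Hom T A B" "g \<in> Hom T B C"
  using assms by (auto simp: conflation_def dest: realizesD)

lemma realizes_exists:
  assumes "A \<in> obj T" "C \<in> obj T" "\<delta> \<in> Ext T C A"
  obtains B f g where "realizes T C A \<delta> B f g"
proof -
  have "realization T C A \<delta> \<in> sequences T A C // seq_rel T A C"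
    using realization_class assms by blast
  then obtain x where "x \<in> sequences T A C" "realization T C A \<delta> = seq_rel T A C `` {x}"
    by (auto elim: quotientE)
  then show thesis using that assms unfolding realizes_def by (cases x) auto
qed

lemma realizes_related:
  assumes "realizes T C A \<delta> B f g" "realizes T C A \<delta> B' f' g'"
  shows "((B, f, g), (B', f', g')) \<in> seq_rel T A C"
  using assms eq_equiv_class[OF _ equiv_seq_rel] unfolding realizes_def by metis

lemma realizes_transport:
  assumes "realizes T C A \<delta> B f g" "((B, f, g), (B', f', g')) \<in> seq_rel T A C"
  shows "realizes T C A \<delta> B' f' g'"
  using assms equiv_class_eq[OF equiv_seq_rel assms(2)] unfolding realizes_def
  by (auto simp: seq_rel_def)

lemma push_in_Ext:
  assumes "C \<in> obj T" "A \<in> obj T" "A' \<in> obj T" "a \<in> Hom T A A'" "\<delta> \<in> Ext T C A"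
  shows "push T C a \<delta> \<in> Ext T C A'"
  using ext_map_hom[OF assms(1,1,2,3) ident_in_Hom[OF assms(1)] assms(4)] assms(5)
  unfolding push_def Ext_def by (rule hom_in_carrier)

lemma pull_in_Ext:
  assumes "C \<in> obj T" "C' \<in> obj T" "A \<in> obj T" "c \<in> Hom T C' C" "\<delta> \<in> Ext T C A"
  shows "pull T c A \<delta> \<in> Ext T C' A"
  using ext_map_hom[OF assms(1,2,3,3,4) ident_in_Hom[OF assms(3)]] assms(5)
  unfolding pull_def Ext_def by (rule hom_in_carrier)

lemma push_ident: "\<lbrakk>C \<in> obj T; A \<in> obj T; \<delta> \<in> Ext T C A\<rbrakk> \<Longrightarrow> push T C (ident T A) \<delta> = \<delta>"
  by (simp add: push_def ext_map_ident)

lemma pull_ident: "\<lbrakk>C \<in> obj T; A \<in> obj T; \<delta> \<in> Ext T C A\<rbrakk> \<Longrightarrow> pull T (ident T C) A \<delta> = \<delta>"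
  by (simp add: pull_def ext_map_ident)

lemma push_push:
  assumes "C \<in> obj T" "A \<in> obj T" "A' \<in> obj T" "A'' \<in> obj T"
    "a \<in> Hom T A A'" "a' \<in> Hom T A' A''" "\<delta> \<in> Ext T C A"
  shows "push T C a' (push T C a \<delta>) = push T C (a' \<cdot> a) \<delta>"
  using ext_map_comp[OF assms(1,1,1,2,3,4) ident_in_Hom ident_in_Hom assms(5-7)] assms(1)
    comp_ident_left[OF assms(1,1) ident_in_Hom]
  by (simp add: push_def)

lemma pull_pull:
  assumes "C \<in> obj T" "C' \<in> obj T" "C'' \<in> obj T" "A \<in> obj T"
    "c \<in> Hom T C' C" "c' \<in> Hom T C'' C'" "\<delta> \<in> Ext T C A"
  shows "pull T c' A (pull T c A \<delta>) = pull T (c \<cdot> c') A \<delta>"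
  using ext_map_comp[OF assms(1-4,4,4,5,6) ident_in_Hom ident_in_Hom assms(7)] assms(4)
    comp_ident_left[OF assms(4,4) ident_in_Hom]
  by (simp add: pull_def)

lemma push_add_arr:
  assumes "C \<in> obj T" "A \<in> obj T" "A' \<in> obj T" "a \<in> Hom T A A'" "b \<in> Hom T A A'" "\<delta> \<in> Ext T C A"
  shows "push T C (a \<otimes>\<^bsub>hom_group T A A'\<^esub> b) \<delta>
    = push T C a \<delta> \<otimes>\<^bsub>ext_group T C A'\<^esub> push T C b \<delta>"
  unfolding push_def using ext_map_add_right assms ident_in_Hom by blast

lemma push_add:
  assumes "C \<in> obj T" "A \<in> obj T" "A' \<in> obj T" "a \<in> Hom T A A'" "\<delta> \<in> Ext T C A" "\<epsilon> \<in> Ext T C A"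
  shows "push T C a (\<delta> \<otimes>\<^bsub>ext_group T C A\<^esub> \<epsilon>)
    = push T C a \<delta> \<otimes>\<^bsub>ext_group T C A'\<^esub> push T C a \<epsilon>"
  using ext_map_hom[OF assms(1,1,2,3) ident_in_Hom[OF assms(1)] assms(4)] assms(5,6)
  unfolding push_def Ext_def by (simp add: hom_mult)

lemma push_zero:
  assumes "C \<in> obj T" "A \<in> obj T" "A' \<in> obj T" "\<delta> \<in> Ext T C A"
  shows "push T C \<one>\<^bsub>hom_group T A A'\<^esub> \<delta> = \<one>\<^bsub>ext_group T C A'\<^esub>"
proof -
  interpret H: comm_group "hom_group T A A'" using assms comm_group_hom_group by blast
  interpret E: comm_group "ext_group T C A'" using assms comm_group_ext_group by blast
  let ?x = "push T C \<one>\<^bsub>hom_group T A A'\<^esub> \<delta>"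
  have "?x \<otimes>\<^bsub>ext_group T C A'\<^esub> ?x = ?x"
    using push_add_arr[OF assms(1-3) zero_in_Hom zero_in_Hom assms(4)] assms by simp
  moreover have "?x \<in> carrier (ext_group T C A')"
    using push_in_Ext[OF assms(1-3) zero_in_Hom assms(4)] assms by (simp add: Ext_def)
  ultimately show ?thesis by (simp add: E.l_cancel_one)
qed

text \<open>
  Half of the exactness of $\mathrm{Hom}(B,D)\to\mathrm{Hom}(A,D)\to\mathbb{E}(C,D)$: a morphism of extensions
  from \<open>\<delta>\<close> to the split extension of \<open>C\<close> by \<open>D\<close> has a middle arrow, and its component into \<open>D\<close>
  is the factorization.
\<close>

lemma factor_through_inflation:
  assumes r: "realizes T C A \<delta> B f g" and D: "D \<in> obj T" and u: "u \<in> Hom T A D"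
    and zero: "push T C u \<delta> = \<one>\<^bsub>ext_group T C D\<^esub>"
  shows "\<exists>v\<in>Hom T B D. v \<cdot> f = u"
proof -
  note o = realizesD[OF r]
  obtain S i j p q where b: "biproduct T D C S i j p q" using biproduct_exists D o by blast
  have bS: "S \<in> obj T" "i \<in> Hom T D S" "p \<in> Hom T S D" "p \<cdot> i = ident T D"
    using b by (auto simp: biproduct_def)
  have r': "realizes T C D \<one>\<^bsub>ext_group T C D\<^esub> S i q" using realization_zero[OF b] .
  obtain m where m: "m \<in> Hom T B S" "m \<cdot> f = i \<cdot> u"
    using realization_morphism[OF r r' u ident_in_Hom[OF o(3)]] zero
      pull_ident[OF o(3) D] realizesD(4)[OF r'] by metis
  have "(p \<cdot> m) \<cdot> f = p \<cdot> (i \<cdot> u)" using comp_assoc[OF o(1,2) bS(1) D o(5) m(1) bS(3)] m by simp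
  also have "\<dots> = u" using comp_assoc[OF o(1) D bS(1) D u bS(2,3)] bS comp_ident_left[OF o(1) D u] by simp
  finally show ?thesis using comp_in_Hom[OF o(2) bS(1) D m(1) bS(3)] by blast
qed

lemma biproduct_zero_right:
  assumes Z: "zero_object T Z" and A: "A \<in> obj T"
  shows "\<exists>j p. biproduct T A Z A (ident T A) j p \<one>\<^bsub>hom_group T A Z\<^esub>"
proof -
  have Zo: "Z \<in> obj T" using Z by (simp add: zero_object_def)
  interpret G: comm_group "hom_group T A A" using A comm_group_hom_group by blast
  have "ident T A \<in> carrier (hom_group T A A)" using ident_in_Hom[OF A] by (simp add: Hom_def)
  then have "biproduct T A Z A (ident T A) \<one>\<^bsub>hom_group T Z A\<^esub> (ident T A) \<one>\<^bsub>hom_group T A Z\<^esub>"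
    unfolding biproduct_def using Zo A zero_in_Hom zero_object_arr(1)[OF Z Zo]
    by (auto simp: ident_in_Hom comp_zero_left comp_zero_right comp_ident_left)
  then show ?thesis by blast
qed

text \<open>
  An inflation is a weak kernel of its deflation.  The arrow \<open>u\<close> and the zero arrow form a map of
  deflations from \<open>M \<rightarrow> 0\<close>, whose cocone is \<open>M\<close> itself, and (ET3)\<open>\<^sup>o\<^sup>p\<close> supplies the map of cocones.
\<close>

lemma lift_along_inflation:
  assumes r: "realizes T C A \<delta> B f g" and M: "M \<in> obj T" and u: "u \<in> Hom T M B"
    and zero: "g \<cdot> u = \<one>\<^bsub>hom_group T M C\<^esub>"
  shows "\<exists>w\<in>Hom T M A. f \<cdot> w = u"
proof -
  note o = realizesD[OF r]
  obtain Z where Z: "zero_object T Z" using zero_object_exists by blast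
  then have Zo: "Z \<in> obj T" by (simp add: zero_object_def)
  obtain j p where b: "biproduct T M Z M (ident T M) j p \<one>\<^bsub>hom_group T M Z\<^esub>"
    using biproduct_zero_right[OF Z M] by blast
  have "\<one>\<^bsub>hom_group T Z C\<^esub> \<cdot> \<one>\<^bsub>hom_group T M Z\<^esub> = g \<cdot> u"
    using zero comp_zero_left[OF M Zo o(3) zero_in_Hom[OF M Zo]] by simp
  then obtain w where "w \<in> Hom T M A" "u \<cdot> ident T M = f \<cdot> w"
    using ET3_op[OF realization_zero[OF b] r u zero_in_Hom[OF Zo o(3)]] by blast
  then show ?thesis using comp_ident_right[OF M o(2) u] by metis
qed

text \<open>
  Let \<open>u = 1 - a\<close>.  Then \<open>u\<close> kills \<open>\<delta>\<close>, so it factors through the inflation \<open>f\<close>, while \<open>f u = 0\<close>.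
  Hence \<open>u\<^sup>2 = 0\<close>.
\<close>

lemma end_invertible_of_cocone:
  assumes r: "realizes T C A \<delta> B f g" and a: "a \<in> Hom T A A"
    and f: "f \<cdot> a = f" and \<delta>: "push T C a \<delta> = \<delta>"
  shows "\<exists>x\<in>Hom T A A. x \<cdot> a = ident T A \<and> a \<cdot> x = ident T A"
proof -
  note o = realizesD[OF r]
  interpret E: comm_group "ext_group T C A" using o comm_group_ext_group by blast
  obtain u where u: "u \<in> Hom T A A" "a \<otimes>\<^bsub>hom_group T A A\<^esub> u = ident T A"
    using ident_split[OF o(1) a] .
  have "\<delta> \<otimes>\<^bsub>ext_group T C A\<^esub> push T C u \<delta> = \<delta>"
    using push_add_arr[OF o(3,1,1) a u(1) o(4)] u \<delta> push_ident[OF o(3,1,4)] by simp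
  then have "push T C u \<delta> = \<one>\<^bsub>ext_group T C A\<^esub>"
    using o push_in_Ext[OF o(3,1,1) u(1) o(4)] by (simp add: Ext_def E.l_cancel_one)
  then obtain v where v: "v \<in> Hom T B A" "v \<cdot> f = u"
    using factor_through_inflation[OF r o(1) u(1)] by blast
  have "f \<cdot> u = \<one>\<^bsub>hom_group T A B\<^esub>"
    using comp_complement_zero_right[OF o(1,2) a u o(5) f] .
  then have "u \<cdot> u = \<one>\<^bsub>hom_group T A A\<^esub>"
    using comp_assoc[OF o(1,1,2,1) u(1) o(5) v(1)] v comp_zero_right[OF o(1,2,1) v(1)] by simp
  then show ?thesis using unipotent_invertible[OF o(1) a u] by blast
qed

text \<open>
  Let \<open>u = 1 - b\<close>.  Then \<open>g u = 0\<close>, so \<open>u\<close> factors as \<open>f w\<close>, while \<open>u f = 0\<close>.  Hence \<open>u\<^sup>2 = 0\<close>.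
\<close>

lemma end_invertible_of_middle:
  assumes r: "realizes T C A \<delta> B f g" and b: "b \<in> Hom T B B"
    and f: "b \<cdot> f = f" and g: "g \<cdot> b = g"
  shows "\<exists>x\<in>Hom T B B. x \<cdot> b = ident T B \<and> b \<cdot> x = ident T B"
proof -
  note o = realizesD[OF r]
  obtain u where u: "u \<in> Hom T B B" "b \<otimes>\<^bsub>hom_group T B B\<^esub> u = ident T B"
    using ident_split[OF o(2) b] .
  have uf: "u \<cdot> f = \<one>\<^bsub>hom_group T A B\<^esub>"
    using comp_complement_zero_left[OF o(2,1) b u o(5) f] .
  have "g \<cdot> u = \<one>\<^bsub>hom_group T B C\<^esub>"
    using comp_complement_zero_right[OF o(2,3) b u o(6) g] .
  then obtain w where w: "w \<in> Hom T B A" "f \<cdot> w = u"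
    using lift_along_inflation[OF r o(2) u(1)] by blast
  have "u \<cdot> u = \<one>\<^bsub>hom_group T B B\<^esub>"
    using comp_assoc[OF o(2,1,2,2) w(1) o(5) u(1)] w uf comp_zero_left[OF o(2,1,2) w(1)] by simp
  then show ?thesis using unipotent_invertible[OF o(2) b u] by blast
qed

text \<open>
  The identity of the deflation induces arrows between the cocones in both directions.  They are not
  unique, but either composite fixes the inflation and the extension, so it is invertible.
\<close>

lemma cocones_isomorphic:
  assumes c: "conflation T A f B g C" and c': "conflation T A' f' B g C"
  shows "\<exists>a. iso_arr T A A' a"
proof -
  obtain \<delta> \<delta>' where r: "realizes T C A \<delta> B f g" and r': "realizes T C A' \<delta>' B f' g"
    using c c' by (auto simp: conflation_def)
  note o = realizesD[OF r] and o' = realizesD[OF r']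
  have *: "\<exists>a\<in>Hom T A A'. f' \<cdot> a = f \<and> push T C a \<delta> = \<delta>'"
    if "realizes T C A \<delta> B f g" "realizes T C A' \<delta>' B f' g" for A f \<delta> A' f' \<delta>'
  proof -
    note o = realizesD[OF that(1)] and o' = realizesD[OF that(2)]
    show ?thesis
      using ET3_op[OF that ident_in_Hom[OF o(2)] ident_in_Hom[OF o(3)]] comp_ident_left[OF o(2,3,6)]
        comp_ident_right[OF o(2,3,6)] comp_ident_left[OF o(1,2,5)] pull_ident[OF o(3) o'(1,4)] by auto
  qed
  obtain a where a: "a \<in> Hom T A A'" "f' \<cdot> a = f" "push T C a \<delta> = \<delta>'" using *[OF r r'] by blast
  obtain b where b: "b \<in> Hom T A' A" "f \<cdot> b = f'" "push T C b \<delta>' = \<delta>" using *[OF r' r] by blast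
  have "b \<cdot> a \<in> Hom T A A" "f \<cdot> (b \<cdot> a) = f" "push T C (b \<cdot> a) \<delta> = \<delta>"
    using comp_in_Hom[OF o(1) o'(1) o(1) a(1) b(1)] comp_assoc[OF o(1) o'(1) o(1,2) a(1) b(1) o(5)] a b
      push_push[OF o(3,1) o'(1) o(1) a(1) b(1) o(4)] by auto
  then obtain x where x: "x \<in> Hom T A A" "x \<cdot> (b \<cdot> a) = ident T A"
    using end_invertible_of_cocone[OF r] by blast
  have "a \<cdot> b \<in> Hom T A' A'" "f' \<cdot> (a \<cdot> b) = f'" "push T C (a \<cdot> b) \<delta>' = \<delta>'"
    using comp_in_Hom[OF o'(1) o(1) o'(1) b(1) a(1)] comp_assoc[OF o'(1) o(1) o'(1,2) b(1) a(1) o'(5)] a b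
      push_push[OF o(3) o'(1) o(1) o'(1) b(1) a(1) o'(4)] by auto
  then obtain y where "y \<in> Hom T A' A'" "(a \<cdot> b) \<cdot> y = ident T A'"
    using end_invertible_of_cocone[OF r'] by blast
  then show ?thesis using iso_arr_from_inverses[OF o(1) o'(1) a(1) b(1) x] by blast
qed

lemma conflation_iso_middle:
  assumes c: "conflation T A f B g C" and b: "iso_arr T B B' b" and B': "B' \<in> obj T"
  shows "\<exists>f' g'. conflation T A f' B' g' C"
proof -
  obtain \<delta> where r: "realizes T C A \<delta> B f g" using c by (auto simp: conflation_def)
  note o = realizesD[OF r]
  obtain b' where b': "iso_arr T B' B b'" "b' \<cdot> b = ident T B" "b \<cdot> b' = ident T B'"
    using iso_arr_inverse[OF b] .
  have h: "b \<in> Hom T B B'" "b' \<in> Hom T B' B" using b b' by (auto simp: iso_arr_def)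
  have "g = (g \<cdot> b') \<cdot> b"
    using comp_assoc[OF o(2) B' o(2,3) h o(6)] b' comp_ident_right[OF o(2,3,6)] by simp
  then have "((B, f, g), (B', b \<cdot> f, g \<cdot> b')) \<in> seq_rel T A C"
    using o b B' comp_in_Hom[OF o(1,2) B' o(5) h(1)] comp_in_Hom[OF B' o(2,3) h(2) o(6)]
    unfolding seq_rel_def sequences_def by auto
  then show ?thesis using realizes_transport[OF r] unfolding conflation_def by blast
qed

text \<open>
  Realize the pullback of \<open>\<delta>\<close> along the inverse of \<open>c\<close>.  Its middle term receives an arrow from \<open>B\<close> and
  maps back to \<open>B\<close>; either composite fixes both ends, so these arrows are isomorphisms.
\<close>

lemma conflation_iso_right:
  assumes cf: "conflation T A f B g C" and c: "iso_arr T C C' c" and C': "C' \<in> obj T"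
  shows "conflation T A f B (c \<cdot> g) C'"
proof -
  obtain \<delta> where r: "realizes T C A \<delta> B f g" using cf by (auto simp: conflation_def)
  note o = realizesD[OF r]
  obtain d where d: "iso_arr T C' C d" "d \<cdot> c = ident T C" "c \<cdot> d = ident T C'"
    using iso_arr_inverse[OF c] .
  have h: "c \<in> Hom T C C'" "d \<in> Hom T C' C" using c d by (auto simp: iso_arr_def)
  let ?\<epsilon> = "pull T d A \<delta>"
  have \<epsilon>: "?\<epsilon> \<in> Ext T C' A" using pull_in_Ext[OF o(3) C' o(1) h(2) o(4)] .
  obtain B' f' g' where r': "realizes T C' A ?\<epsilon> B' f' g'"
    using realizes_exists[OF o(1) C' \<epsilon>] .
  note o' = realizesD[OF r'] and id = ident_in_Hom[OF o(1)]
  have "push T C (ident T A) \<delta> = pull T c A ?\<epsilon>"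
    using pull_pull[OF o(3) C' o(3,1) h(2,1) o(4)] d pull_ident[OF o(3,1,4)] push_ident[OF o(3,1,4)]
    by simp
  then obtain b where b: "b \<in> Hom T B B'" "b \<cdot> f = f'" "g' \<cdot> b = c \<cdot> g"
    using realization_morphism[OF r r' id h(1)] comp_ident_right[OF o'(1,2,5)] by auto
  have "push T C' (ident T A) ?\<epsilon> = pull T d A \<delta>"
    using push_ident[OF C' o(1) \<epsilon>] .
  then obtain b' where b': "b' \<in> Hom T B' B" "b' \<cdot> f' = f" "g \<cdot> b' = d \<cdot> g'"
    using realization_morphism[OF r' r id h(2)] comp_ident_right[OF o(1,2,5)] by auto
  have "b' \<cdot> b \<in> Hom T B B" using comp_in_Hom[OF o(2) o'(2) o(2) b(1) b'(1)] .
  moreover have "(b' \<cdot> b) \<cdot> f = f" using comp_assoc[OF o(1,2) o'(2) o(2,5) b(1) b'(1)] b b' by simp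
  moreover have "g \<cdot> (b' \<cdot> b) = g"
  proof -
    have "g \<cdot> (b' \<cdot> b) = d \<cdot> (c \<cdot> g)"
      using comp_assoc[OF o(2) o'(2) o(2,3) b(1) b'(1) o(6)] b b'
        comp_assoc[OF o(2) o'(2,3) o(3) b(1) o'(6) h(2)] by simp
    then show ?thesis using comp_assoc[OF o(2,3) C' o(3,6) h] d comp_ident_left[OF o(2,3,6)] by simp
  qed
  ultimately obtain x where x: "x \<in> Hom T B B" "x \<cdot> (b' \<cdot> b) = ident T B"
    using end_invertible_of_middle[OF r] by blast
  have "b \<cdot> b' \<in> Hom T B' B'" using comp_in_Hom[OF o'(2) o(2) o'(2) b'(1) b(1)] .
  moreover have "(b \<cdot> b') \<cdot> f' = f'" using comp_assoc[OF o'(1,2) o(2) o'(2,5) b'(1) b(1)] b b' by simp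
  moreover have "g' \<cdot> (b \<cdot> b') = g'"
  proof -
    have "g' \<cdot> (b \<cdot> b') = c \<cdot> (d \<cdot> g')"
      using comp_assoc[OF o'(2) o(2) o'(2,3) b'(1) b(1) o'(6)] b b'
        comp_assoc[OF o'(2) o(2,3) C' b'(1) o(6) h(1)] by simp
    then show ?thesis using comp_assoc[OF o'(2) C' o(3) C' o'(6) h(2,1)] d comp_ident_left[OF o'(2,3,6)] by simp
  qed
  ultimately obtain y where y: "y \<in> Hom T B' B'" "(b \<cdot> b') \<cdot> y = ident T B'"
    using end_invertible_of_middle[OF r'] by blast
  have "iso_arr T B B' b" using iso_arr_from_inverses[OF o(2) o'(2) b(1) b'(1) x y] .
  then have "((B, f, c \<cdot> g), (B', f', g')) \<in> seq_rel T A C'"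
    using o o' b comp_in_Hom[OF o(2,3) C' o(6) h(1)] unfolding seq_rel_def sequences_def by auto
  then have "((B', f', g'), (B, f, c \<cdot> g)) \<in> seq_rel T A C'"
    using equiv_seq_rel[OF o(1) C'] by (meson equivE symE)
  then show ?thesis using realizes_transport[OF r'] unfolding conflation_def by blast
qed

lemma conflation_of_iso:
  assumes "zero_object T Z" "A \<in> obj T" "B \<in> obj T" "iso_arr T A B a"
  shows "\<exists>i. conflation T Z i A a B"
  using biproduct_zero_left[OF assms] realization_zero unfolding conflation_def by blast

text \<open>
  This is the part of (ET4)\<open>\<^sup>o\<^sup>p\<close> that is needed: the cocone \<open>E\<close> of the composite is an extension of the
  cocone \<open>A\<close> of the first deflation by the cocone \<open>D\<close> of the second.
\<close>

lemma composite_deflation: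
  assumes "conflation T A f B g C" and "conflation T D f' X g' B"
  shows "\<exists>E h e d. conflation T E h X (g \<cdot> g') C \<and> conflation T D e E d A"
proof -
  obtain \<delta> \<delta>' where "realizes T C A \<delta> B f g" "realizes T B D \<delta>' X f' g'"
    using assms unfolding conflation_def by blast
  from ET4_op[OF this] show ?thesis unfolding conflation_def by blast
qed

text \<open>
  Compose the split inflation \<open>A1 \<rightarrow> A1 \<oplus> A2\<close> with the inflation of \<open>\<nu>\<close>.  By (ET4) the composite has a
  cone \<open>E\<close> that realizes the component of \<open>\<nu>\<close> in \<open>A2\<close>, so \<open>E\<close> may be replaced by \<open>B2\<close>.
\<close>

lemma deflation_from_sum_extension:
  assumes b: "biproduct T A1 A2 S i1 i2 p1 p2"
    and \<nu>: "realizes T C S \<nu> M j k"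
    and r: "realizes T C A2 (push T C p2 \<nu>) B2 x2 y2"
  shows "\<exists>m k1. conflation T A1 k1 M m B2 \<and> y2 \<cdot> m = k"
proof -
  note o\<nu> = realizesD[OF \<nu>] and o = realizesD[OF r]
  obtain E h d e \<delta>'' where E: "E \<in> obj T" "h \<in> Hom T M E" "e \<cdot> h = k" "e \<in> Hom T E C"
      "realizes T E A1 \<delta>'' M (j \<cdot> i1) h" "realizes T C A2 (push T C p2 \<nu>) E d e"
    using ET4[OF realization_zero[OF b] \<nu>] by metis
  obtain c where c: "iso_arr T E B2 c" "e = y2 \<cdot> c"
    using realizes_related[OF E(6) r] unfolding seq_rel_def by blast
  have "c \<in> Hom T E B2" using c by (simp add: iso_arr_def)
  then have "y2 \<cdot> (c \<cdot> h) = k"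
    using comp_assoc[OF o\<nu>(2) E(1) o(2,3) E(2) _ o(6)] c E by simp
  moreover have "conflation T A1 (j \<cdot> i1) M h E" using E(5) unfolding conflation_def by blast
  then have "conflation T A1 (j \<cdot> i1) M (c \<cdot> h) B2"
    using conflation_iso_right c(1) o(2) by blast
  ultimately show ?thesis by blast
qed

text \<open>
  The common middle term \<open>M\<close> realizes the extension of \<open>C\<close> by \<open>A1 \<oplus> A2\<close> with components \<open>\<delta>1\<close> and \<open>\<delta>2\<close>.
  Collapsing \<open>A1\<close> or \<open>A2\<close> leaves the other conflation.  Pullbacks need not exist; the commutative square
  with its two pairs of equal cocones does their work for resolutions.
\<close>

lemma pullback_of_deflations:
  assumes "conflation T A1 x1 B1 y1 C" and "conflation T A2 x2 B2 y2 C"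
  shows "\<exists>M k1 m1 k2 m2. conflation T A1 k2 M m2 B2 \<and> conflation T A2 k1 M m1 B1 \<and> y1 \<cdot> m1 = y2 \<cdot> m2"
proof -
  obtain \<delta>1 \<delta>2 where r1: "realizes T C A1 \<delta>1 B1 x1 y1" and r2: "realizes T C A2 \<delta>2 B2 x2 y2"
    using assms by (auto simp: conflation_def)
  note o1 = realizesD[OF r1] and o2 = realizesD[OF r2]
  obtain S i1 i2 p1 p2 where b: "biproduct T A1 A2 S i1 i2 p1 p2"
    using biproduct_exists o1 o2 by blast
  have bS: "S \<in> obj T" "i1 \<in> Hom T A1 S" "i2 \<in> Hom T A2 S" "p1 \<in> Hom T S A1" "p2 \<in> Hom T S A2"
    "p1 \<cdot> i1 = ident T A1" "p2 \<cdot> i2 = ident T A2"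
    "p2 \<cdot> i1 = \<one>\<^bsub>hom_group T A1 A2\<^esub>" "p1 \<cdot> i2 = \<one>\<^bsub>hom_group T A2 A1\<^esub>"
    using b by (auto simp: biproduct_def)
  interpret ES: comm_group "ext_group T C S" using o1 bS comm_group_ext_group by blast
  interpret E1: comm_group "ext_group T C A1" using o1 bS comm_group_ext_group by blast
  interpret E2: comm_group "ext_group T C A2" using o1 o2 bS comm_group_ext_group by blast
  have e: "push T C i1 \<delta>1 \<in> Ext T C S" "push T C i2 \<delta>2 \<in> Ext T C S"
    using push_in_Ext o1 o2 bS by blast+
  let ?\<nu> = "push T C i1 \<delta>1 \<otimes>\<^bsub>ext_group T C S\<^esub> push T C i2 \<delta>2"
  have "?\<nu> \<in> Ext T C S" using e by (simp add: Ext_def)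
  then obtain M j k where \<nu>: "realizes T C S ?\<nu> M j k" using realizes_exists[OF bS(1) o1(3)] by blast
  have "push T C p1 ?\<nu> = \<delta>1"
    using push_add[OF o1(3) bS(1) o1(1) bS(4) e] push_push[OF o1(3,1) bS(1) o1(1) bS(2,4) o1(4)]
      push_push[OF o1(3) o2(1) bS(1) o1(1) bS(3,4) o2(4)] push_ident[OF o1(3,1,4)]
      push_zero[OF o1(3) o2(1) o1(1) o2(4)] bS o1(4) by (simp add: Ext_def)
  moreover have "push T C p2 ?\<nu> = \<delta>2"
    using push_add[OF o1(3) bS(1) o2(1) bS(5) e] push_push[OF o1(3,1) bS(1) o2(1) bS(2,5) o1(4)]
      push_push[OF o1(3) o2(1) bS(1) o2(1) bS(3,5) o2(4)] push_ident[OF o2(3,1,4)]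
      push_zero[OF o1(3,1) o2(1) o1(4)] bS o2(4) by (simp add: Ext_def)
  ultimately have "\<exists>m k1. conflation T A1 k1 M m B2 \<and> y2 \<cdot> m = k"
    "\<exists>m k1. conflation T A2 k1 M m B1 \<and> y1 \<cdot> m = k"
    using deflation_from_sum_extension[OF b \<nu>] deflation_from_sum_extension[OF biproduct_swap[OF b] \<nu>]
      r1 r2 by simp_all
  then show ?thesis by metis
qed

end

section \<open>Euler characteristics of resolutions\<close>

text \<open>
  The target \<open>G\<close> of \<open>cls\<close> is an arbitrary abelian group: the heart of the matter is that an additive
  function on \<open>\<S>\<close> extends uniquely to the whole category, and Grothendieck groups are the
  universal targets of such functions.
\<close>

locale additive_on_resolving = extriangulated T
  for T :: "('o, 'm, 'e, 'z) extri_data_scheme" (structure) +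
  fixes \<S> :: "'o set" and G :: "('g, 'h) monoid_scheme" and cls :: "'o \<Rightarrow> 'g"
  assumes comm_group_target: "comm_group G"
    and closed_ext: "extension_closed T \<S>"
    and closed_cocone: "cocone_closed T \<S>"
    and resolution_exists: "A \<in> obj T \<Longrightarrow> \<exists>n Xs d. finite_resolution T \<S> A n Xs d"
    and cls_in: "A \<in> \<S> \<Longrightarrow> cls A \<in> carrier G"
    and cls_conflation:
      "\<lbrakk>conflation T A f B g C; A \<in> \<S>; B \<in> \<S>; C \<in> \<S>\<rbrakk> \<Longrightarrow> cls B = cls A \<otimes>\<^bsub>G\<^esub> cls C"

sublocale additive_on_resolving \<subseteq> G: comm_group G
  by (rule comm_group_target)

text \<open>
  A zero object of the full subcategory has only one endomorphism, so its identity is zero and it is a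
  zero object of the ambient category.
\<close>

lemma (in extriangulated) zero_object_of_subcategory:
  assumes "extension_closed T \<S>"
  shows "\<exists>Z\<in>\<S>. zero_object T Z"
proof -
  have sub: "\<S> \<subseteq> obj T" and "additive_category (full_sub T \<S>)"
    using assms by (auto simp: extension_closed_def)
  then obtain Z where Z: "zero_object (full_sub T \<S>) Z"
    using additive_category.zero_object_exists by blast
  then have ZS: "Z \<in> \<S>" and uniq: "\<exists>!f. f \<in> Hom T Z Z"
    unfolding zero_object_def by (simp_all add: full_sub_def Hom_def)
  have Zo: "Z \<in> obj T" using ZS sub by blast
  have "ident T Z = \<one>\<^bsub>hom_group T Z Z\<^esub>"
    using uniq ident_in_Hom[OF Zo] zero_in_Hom[OF Zo Zo] by blast
  then show ?thesis using ZS zero_objectI[OF Zo] by blast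
qed

context additive_on_resolving
begin

lemma sub_obj: "A \<in> \<S> \<Longrightarrow> A \<in> obj T"
  using closed_ext unfolding extension_closed_def by blast

lemma sub_extension: "\<lbrakk>conflation T A f B g C; A \<in> \<S>; C \<in> \<S>\<rbrakk> \<Longrightarrow> B \<in> \<S>"
  using closed_ext unfolding extension_closed_def by blast

lemma sub_cocone: "\<lbrakk>conflation T A f B g C; B \<in> \<S>; C \<in> \<S>\<rbrakk> \<Longrightarrow> A \<in> \<S>"
  using closed_cocone unfolding cocone_closed_def by blast

lemma zero_conflation:
  obtains Z where "Z \<in> \<S>" "cls Z = \<one>\<^bsub>G\<^esub>"
    "\<And>A B a. \<lbrakk>A \<in> obj T; B \<in> obj T; iso_arr T A B a\<rbrakk> \<Longrightarrow> \<exists>i. conflation T Z i A a B"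
proof -
  obtain Z where Z: "Z \<in> \<S>" "zero_object T Z"
    using zero_object_of_subcategory[OF closed_ext] by blast
  note * = conflation_of_iso[OF Z(2)]
  obtain i where "conflation T Z i Z (ident T Z) Z"
    using *[OF sub_obj[OF Z(1)] sub_obj[OF Z(1)] iso_arr_ident[OF sub_obj[OF Z(1)]]] by blast
  then have "cls Z = \<one>\<^bsub>G\<^esub>" using cls_conflation[of Z i Z _ Z] Z cls_in[of Z] by (simp add: G.l_cancel_one)
  then show thesis using that Z * by blast
qed

text \<open>
  \<open>euler n C v\<close> means that some resolution of \<open>C\<close> of length \<open>n\<close> has alternating sum \<open>v\<close>.  The step is
  stated as \<open>v + k = cls X\<close> rather than \<open>v = cls X - k\<close>, so that the comparisons below are
  calculations with sums followed by one cancellation.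
\<close>

primrec euler :: "nat \<Rightarrow> 'o \<Rightarrow> 'g \<Rightarrow> bool" where
  "euler 0 C v \<longleftrightarrow> C \<in> \<S> \<and> v = cls C"
| "euler (Suc n) C v \<longleftrightarrow> v \<in> carrier G \<and>
     (\<exists>K f X g k. conflation T K f X g C \<and> X \<in> \<S> \<and> euler n K k \<and> v \<otimes>\<^bsub>G\<^esub> k = cls X)"

lemma euler_in: "euler n C v \<Longrightarrow> C \<in> obj T \<and> v \<in> carrier G"
  by (cases n) (auto simp: sub_obj cls_in dest: conflationD)

lemma euler_of_resolution:
  "finite_resolution T \<S> A n Xs d \<Longrightarrow>
   euler n A (\<Otimes>\<^bsub>G\<^esub>i\<in>{..n}. cls (Xs i) [^]\<^bsub>G\<^esub> ((- 1) ^ i :: int))"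
proof (induction n arbitrary: A Xs d)
  case 0
  then have "A \<in> \<S>" "Xs 0 = A" by (auto simp: finite_resolution_def)
  then show ?case using cls_in by simp
next
  case (Suc n)
  obtain Cs f g where C: "\<And>i. i \<le> Suc n \<Longrightarrow> Xs i \<in> \<S>" "Cs 0 = A" "Cs (Suc n) = Xs (Suc n)"
    "g (Suc n) = ident T (Xs (Suc n))"
    "\<And>i. i < Suc n \<Longrightarrow> conflation T (Cs (Suc i)) (f i) (Xs i) (g i) (Cs i)"
    "\<And>i. i < Suc n \<Longrightarrow> d (Suc i) = f i \<cdot> g (Suc i)"
    using Suc.prems unfolding finite_resolution_def by auto
  let ?Xs = "\<lambda>i. Xs (Suc i)"
  \<comment> \<open>Truncation at the first syzygy; its augmentation is \<open>g 1\<close>, not the differential \<open>d 1 = f 0 \<cdot> g 1\<close>.\<close>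
  have "finite_resolution T \<S> (Cs 1) n ?Xs (\<lambda>i. if i = 0 then g 1 else d (Suc i))"
    unfolding finite_resolution_def
    by (intro conjI exI[of _ "\<lambda>i. Cs (Suc i)"] exI[of _ "\<lambda>i. f (Suc i)"] exI[of _ "\<lambda>i. g (Suc i)"])
      (use C in auto)
  from Suc.IH[OF this]
  have IH: "euler n (Cs 1) (\<Otimes>\<^bsub>G\<^esub>i\<in>{..n}. cls (?Xs i) [^]\<^bsub>G\<^esub> ((- 1) ^ i :: int))" (is "euler n _ ?k") .
  have X: "cls (Xs i) \<in> carrier G" if "i \<le> Suc n" for i using that C(1) cls_in by blast
  \<comment> \<open>The terms of index at least 1 in the sum for \<open>A\<close>: the negative of the sum for the syzygy.\<close>
  let ?w = "\<Otimes>\<^bsub>G\<^esub>i\<in>{..n}. cls (?Xs i) [^]\<^bsub>G\<^esub> ((- 1) ^ Suc i :: int)"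
  have w: "?w \<in> carrier G" and k: "?k \<in> carrier G" using X by (auto intro!: G.finprod_closed)
  have "?w \<otimes>\<^bsub>G\<^esub> ?k = (\<Otimes>\<^bsub>G\<^esub>i\<in>{..n}.
      cls (?Xs i) [^]\<^bsub>G\<^esub> ((- 1) ^ Suc i :: int) \<otimes>\<^bsub>G\<^esub> cls (?Xs i) [^]\<^bsub>G\<^esub> ((- 1) ^ i :: int))"
    using X by (intro G.finprod_multf[symmetric]) auto
  also have "\<dots> = (\<Otimes>\<^bsub>G\<^esub>i\<in>{..n}. \<one>\<^bsub>G\<^esub>)"
    using X by (intro G.finprod_cong') (auto simp flip: G.int_pow_mult)
  finally have wk: "?w \<otimes>\<^bsub>G\<^esub> ?k = \<one>\<^bsub>G\<^esub>" by simp
  have "(\<Otimes>\<^bsub>G\<^esub>i\<in>{..Suc n}. cls (Xs i) [^]\<^bsub>G\<^esub> ((- 1) ^ i :: int)) = ?w \<otimes>\<^bsub>G\<^esub> cls (Xs 0)"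
    using X by (subst G.finprod_Suc2) auto
  moreover have "?w \<otimes>\<^bsub>G\<^esub> cls (Xs 0) \<otimes>\<^bsub>G\<^esub> ?k = cls (Xs 0)"
  proof -
    have "?w \<otimes>\<^bsub>G\<^esub> cls (Xs 0) \<otimes>\<^bsub>G\<^esub> ?k = ?w \<otimes>\<^bsub>G\<^esub> ?k \<otimes>\<^bsub>G\<^esub> cls (Xs 0)"
      using w k X[of 0] by (simp only: G.m_ac)
    then show ?thesis using wk X[of 0] by simp
  qed
  moreover have "conflation T (Cs 1) (f 0) (Xs 0) (g 0) A" using C(5)[of 0] C(2) by simp
  ultimately show ?case using IH w X[of 0] C(1)[of 0] by auto
qed

lemma euler_raise_Suc: "euler n C v \<Longrightarrow> euler (Suc n) C v"
proof (induction n arbitrary: C v)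
  case 0
  then have C: "C \<in> \<S>" "v = cls C" by auto
  obtain Z where Z: "Z \<in> \<S>" "cls Z = \<one>\<^bsub>G\<^esub>"
    "\<And>A B a. \<lbrakk>A \<in> obj T; B \<in> obj T; iso_arr T A B a\<rbrakk> \<Longrightarrow> \<exists>i. conflation T Z i A a B"
    using zero_conflation by blast
  obtain i where "conflation T Z i C (ident T C) C"
    using Z(3) iso_arr_ident sub_obj[OF C(1)] by blast
  moreover have "euler 0 Z \<one>\<^bsub>G\<^esub>" using Z by simp
  ultimately show ?case
    using C cls_in[OF C(1)] by (subst euler.simps) (metis G.r_one)
next
  case (Suc n)
  obtain K f X g k where "v \<in> carrier G" "conflation T K f X g C" "X \<in> \<S>" "euler n K k"
    "v \<otimes>\<^bsub>G\<^esub> k = cls X" using Suc.prems by auto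
  with Suc.IH[OF this(4)] show ?case by (subst euler.simps) blast
qed

lemma euler_raise: "\<lbrakk>euler n C v; n \<le> m\<rbrakk> \<Longrightarrow> euler m C v"
  using euler_raise_Suc by (induction m) (auto simp: le_Suc_eq simp del: euler.simps(2))

lemma deflation_from_sub:
  assumes "C \<in> obj T"
  obtains K f X g where "conflation T K f X g C" "X \<in> \<S>"
proof -
  obtain n Xs d where "finite_resolution T \<S> C n Xs d" using resolution_exists assms by blast
  from euler_raise_Suc[OF euler_of_resolution[OF this]] show thesis using that by auto
qed

text \<open>
  The common middle term \<open>M\<close> over \<open>L \<rightarrow> K\<close> and the first deflation \<open>X \<rightarrow> K\<close> of a resolution is an
  extension of \<open>X\<close> by \<open>N\<close>, so it lies in \<open>\<S>\<close>, and the cocone of \<open>M \<rightarrow> L\<close> is the same first syzygy.  So \<open>L\<close> is resolved in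
  the same length as \<open>K\<close>.
\<close>

lemma euler_extension_by_sub:
  assumes cf: "conflation T N f L g K" and N: "N \<in> \<S>" and v: "euler n K v"
  shows "euler n L (cls N \<otimes>\<^bsub>G\<^esub> v)"
proof (cases n)
  case 0
  then show ?thesis using cf N v sub_extension[OF cf] cls_conflation[OF cf] by simp
next
  case (Suc m)
  then obtain K' f' X g' k where X: "conflation T K' f' X g' K" "X \<in> \<S>" "euler m K' k"
    "v \<otimes>\<^bsub>G\<^esub> k = cls X" "v \<in> carrier G" using v by auto
  obtain M k1 m1 k2 m2 where M: "conflation T N k2 M m2 X" "conflation T K' k1 M m1 L"
    using pullback_of_deflations[OF cf X(1)] by blast
  have "M \<in> \<S>" "cls M = cls N \<otimes>\<^bsub>G\<^esub> cls X"
    using sub_extension[OF M(1)] cls_conflation[OF M(1)] N X(2) by auto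
  then have "euler (Suc m) L (cls N \<otimes>\<^bsub>G\<^esub> v)"
    using X M(2) cls_in[OF N] euler_in[OF X(3)]
    by (auto simp: G.m_assoc intro!: exI)
  then show ?thesis using Suc by simp
qed

text \<open>
  One dimension shift.  Arbitrary resolutions of \<open>B\<close> and \<open>C\<close> come with no deflation from the first
  syzygy of \<open>B\<close> to that of \<open>C\<close>, so they cannot be subtracted term by term.  Instead a single
  \<open>Y\<close> in \<open>\<S>\<close> covers both \<open>XB\<close> and \<open>XC\<close>.  With \<open>K\<close> the cocone of \<open>Y \<rightarrow> B\<close> and \<open>L\<close> the cocone of \<open>Y \<rightarrow> C\<close>,
  composing \<open>Y \<rightarrow> B \<rightarrow> C\<close> gives a conflation \<open>K \<rightarrow> L \<rightarrow> A\<close>.  It ends in \<open>A\<close> instead of starting there,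
  but \<open>K\<close> and \<open>L\<close> are extensions of first syzygies by objects of \<open>\<S>\<close> and have shorter resolutions.
  The equation says that \<open>b - c = l - k\<close>: both sides compare the class of \<open>Y\<close> with itself.
\<close>

lemma syzygy_conflation:
  assumes cf: "conflation T A f B g C" and b: "euler (Suc n) B b" and c: "euler (Suc n) C c"
  obtains K h L e k l where "conflation T K h L e A" "euler n K k" "euler n L l"
    "b \<otimes>\<^bsub>G\<^esub> k = c \<otimes>\<^bsub>G\<^esub> l"
proof -
  obtain KB fB XB gB kb where B: "conflation T KB fB XB gB B" "XB \<in> \<S>" "euler n KB kb"
    "b \<otimes>\<^bsub>G\<^esub> kb = cls XB" "b \<in> carrier G" using b by auto
  obtain KC fC XC gC kc where C: "conflation T KC fC XC gC C" "XC \<in> \<S>" "euler n KC kc"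
    "c \<otimes>\<^bsub>G\<^esub> kc = cls XC" "c \<in> carrier G" using c by auto
  obtain M fM where M: "conflation T M fM XB (g \<cdot> gB) C"
    using composite_deflation[OF cf B(1)] by blast
  obtain E k1 m1 k2 m2 where E: "conflation T M k2 E m2 XC" "conflation T KC k1 E m1 XB"
    "(g \<cdot> gB) \<cdot> m1 = gC \<cdot> m2"
    using pullback_of_deflations[OF M C(1)] by blast
  \<comment> \<open>The object \<open>E\<close> need not lie in \<open>\<S>\<close>; a deflation onto it from \<open>\<S>\<close> dominates both \<open>XB\<close> and \<open>XC\<close>.\<close>
  obtain J j Y y where Y: "conflation T J j Y y E" "Y \<in> \<S>"
    using deflation_from_sub conflationD(2)[OF E(1)] by blast
  obtain N1 n1 where N1: "conflation T N1 n1 Y (m1 \<cdot> y) XB"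
    using composite_deflation[OF E(2) Y(1)] by blast
  obtain N2 n2 where N2: "conflation T N2 n2 Y (m2 \<cdot> y) XC"
    using composite_deflation[OF E(1) Y(1)] by blast
  have N: "N1 \<in> \<S>" "N2 \<in> \<S>" "cls Y = cls N1 \<otimes>\<^bsub>G\<^esub> cls XB" "cls Y = cls N2 \<otimes>\<^bsub>G\<^esub> cls XC"
    using sub_cocone[OF N1] sub_cocone[OF N2] cls_conflation[OF N1] cls_conflation[OF N2]
      Y(2) B(2) C(2) by auto
  obtain K h e d where K: "conflation T K h Y (gB \<cdot> (m1 \<cdot> y)) B" "conflation T N1 e K d KB"
    using composite_deflation[OF B(1) N1] by blast
  obtain L h' e' d' where L: "conflation T L h' Y (g \<cdot> (gB \<cdot> (m1 \<cdot> y))) C" "conflation T K e' L d' A"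
    using composite_deflation[OF cf K(1)] by blast
  obtain L' h'' e'' d'' where L': "conflation T L' h'' Y (gC \<cdot> (m2 \<cdot> y)) C" "conflation T N2 e'' L' d'' KC"
    using composite_deflation[OF C(1) N2] by blast
  have "g \<cdot> (gB \<cdot> (m1 \<cdot> y)) = gC \<cdot> (m2 \<cdot> y)"
  proof -
    note o = conflationD[OF cf] conflationD[OF B(1)] conflationD[OF C(1)] conflationD[OF E(1)]
      conflationD[OF E(2)] conflationD[OF Y(1)]
    have "m1 \<cdot> y \<in> Hom T Y XB" "g \<cdot> gB \<in> Hom T XB C" using comp_in_Hom o by blast+
    then have "g \<cdot> (gB \<cdot> (m1 \<cdot> y)) = (g \<cdot> gB) \<cdot> (m1 \<cdot> y)" "(g \<cdot> gB) \<cdot> (m1 \<cdot> y) = ((g \<cdot> gB) \<cdot> m1) \<cdot> y"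
      "gC \<cdot> (m2 \<cdot> y) = (gC \<cdot> m2) \<cdot> y"
      using comp_assoc[of Y XB B C "m1 \<cdot> y" gB g] comp_assoc[of Y E XB C y m1 "g \<cdot> gB"]
        comp_assoc[of Y E XC C y m2 gC] o by auto
    then show ?thesis using E(3) by simp
  qed
  \<comment> \<open>The cocone found over \<open>B\<close> and the one found over \<open>XC\<close> belong to the same deflation \<open>Y \<rightarrow> C\<close>, so the
      extension structure of \<open>L'\<close> over the syzygy \<open>KC\<close> carries over to \<open>L\<close>.\<close>
  then obtain a where "iso_arr T L' L a" using cocones_isomorphic L(1) L'(1) by metis
  then obtain p q where LL: "conflation T N2 p L q KC"
    using conflation_iso_middle[OF L'(2)] conflationD(1)[OF L(1)] by blast
  let ?k = "cls N1 \<otimes>\<^bsub>G\<^esub> kb" and ?l = "cls N2 \<otimes>\<^bsub>G\<^esub> kc"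
  have kl: "euler n K ?k" "euler n L ?l"
    using euler_extension_by_sub[OF K(2) N(1) B(3)] euler_extension_by_sub[OF LL N(2) C(3)] .
  have car: "cls N1 \<in> carrier G" "cls N2 \<in> carrier G" "kb \<in> carrier G" "kc \<in> carrier G"
    using N cls_in euler_in B(3) C(3) by auto
  have "b \<otimes>\<^bsub>G\<^esub> ?k = cls N1 \<otimes>\<^bsub>G\<^esub> (b \<otimes>\<^bsub>G\<^esub> kb)" using car B(5) by (simp only: G.m_lcomm)
  also have "\<dots> = cls N2 \<otimes>\<^bsub>G\<^esub> (c \<otimes>\<^bsub>G\<^esub> kc)" using B(4) C(4) N by simp
  also have "\<dots> = c \<otimes>\<^bsub>G\<^esub> ?l" using car C(5) by (simp only: G.m_lcomm)
  finally show thesis using that L(2) kl by blast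
qed

text \<open>
  Two dimension shifts are needed because one leaves the length of \<open>A\<close> unchanged.  The first turns \<open>A \<rightarrow> B \<rightarrow> C\<close> into
  \<open>K \<rightarrow> L \<rightarrow> A\<close>, in which only \<open>A\<close> still has length \<open>n + 1\<close>; the second turns that into \<open>K' \<rightarrow> L' \<rightarrow> K\<close>, where
  all three terms have length \<open>n\<close> and the induction hypothesis applies.
\<close>

lemma euler_conflation:
  "\<lbrakk>conflation T A f B g C; euler n A a; euler n B b; euler n C c\<rbrakk> \<Longrightarrow> b = a \<otimes>\<^bsub>G\<^esub> c"
proof (induction n arbitrary: A f B g C a b c)
  case 0
  then show ?case using cls_conflation by auto
next
  case (Suc n)
  obtain K h L e k l where K: "conflation T K h L e A" "euler n K k" "euler n L l"
    "b \<otimes>\<^bsub>G\<^esub> k = c \<otimes>\<^bsub>G\<^esub> l"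
    using syzygy_conflation[OF Suc.prems(1,3,4)] .
  obtain K' h' L' e' k' l' where K': "conflation T K' h' L' e' K" "euler n K' k'" "euler n L' l'"
    "l \<otimes>\<^bsub>G\<^esub> k' = a \<otimes>\<^bsub>G\<^esub> l'"
    using syzygy_conflation[OF K(1) euler_raise_Suc[OF K(3)] Suc.prems(2)] .
  have car: "a \<in> carrier G" "b \<in> carrier G" "c \<in> carrier G" "k \<in> carrier G" "l \<in> carrier G"
    "k' \<in> carrier G" "l' \<in> carrier G"
    using euler_in Suc.prems K K' by blast+
  have "l' = k' \<otimes>\<^bsub>G\<^esub> k" using Suc.IH[OF K'(1-3) K(2)] .
  then have "l \<otimes>\<^bsub>G\<^esub> k' = a \<otimes>\<^bsub>G\<^esub> k \<otimes>\<^bsub>G\<^esub> k'" using K'(4) car by (simp add: G.m_ac)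
  then have "l = a \<otimes>\<^bsub>G\<^esub> k" using car by simp
  then have "b \<otimes>\<^bsub>G\<^esub> k = a \<otimes>\<^bsub>G\<^esub> c \<otimes>\<^bsub>G\<^esub> k" using K(4) car by (simp add: G.m_ac)
  then show ?case using car by simp
qed

text \<open>
  Additivity on the conflation from zero through \<open>A\<close> to \<open>B\<close>, after padding both resolutions to a common
  length.  For \<open>A = B\<close> this is independence of the resolution.
\<close>

lemma euler_iso_unique:
  assumes "euler n A v" "euler m B w" "(A, B) \<in> iso_rel T"
  shows "v = w"
proof -
  obtain a where a: "A \<in> obj T" "B \<in> obj T" "iso_arr T A B a" using assms(3) by (auto simp: iso_rel_def)
  obtain Z where Z: "Z \<in> \<S>" "cls Z = \<one>\<^bsub>G\<^esub>"
    "\<And>A B a. \<lbrakk>A \<in> obj T; B \<in> obj T; iso_arr T A B a\<rbrakk> \<Longrightarrow> \<exists>i. conflation T Z i A a B"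
    using zero_conflation by blast
  obtain i where "conflation T Z i A a B" using Z(3) a by blast
  moreover have "euler (max n m) A v" "euler (max n m) B w"
    using euler_raise assms by auto
  moreover have "euler (max n m) Z \<one>\<^bsub>G\<^esub>" using euler_raise[of 0 Z "\<one>\<^bsub>G\<^esub>"] Z by simp
  ultimately show ?thesis using euler_conflation euler_in[OF assms(2)] by force
qed

text \<open>
  Classes of objects of \<open>\<S>\<close> generate: along a resolution the value at an object is determined by the
  values on \<open>\<S>\<close>.
\<close>

lemma additive_unique:
  assumes "group H"
    and \<theta>: "\<And>A. A \<in> obj T \<Longrightarrow> \<theta> A \<in> carrier H"
      "\<And>A f B g C. conflation T A f B g C \<Longrightarrow> \<theta> B = \<theta> A \<otimes>\<^bsub>H\<^esub> \<theta> C"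
    and \<eta>: "\<And>A. A \<in> obj T \<Longrightarrow> \<eta> A \<in> carrier H"
      "\<And>A f B g C. conflation T A f B g C \<Longrightarrow> \<eta> B = \<eta> A \<otimes>\<^bsub>H\<^esub> \<eta> C"
    and eq: "\<And>A. A \<in> \<S> \<Longrightarrow> \<theta> A = \<eta> A"
    and A: "A \<in> obj T"
  shows "\<theta> A = \<eta> A"
proof -
  interpret H: group H by (rule assms(1))
  have "\<theta> C = \<eta> C" if "euler n C v" for n C v
    using that
  proof (induction n arbitrary: C v)
    case 0
    then show ?case using eq by simp
  next
    case (Suc n)
    then obtain K f X g k where c: "conflation T K f X g C" "X \<in> \<S>" "euler n K k" by auto
    have "\<eta> K \<otimes>\<^bsub>H\<^esub> \<theta> C = \<eta> K \<otimes>\<^bsub>H\<^esub> \<eta> C"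
      using \<theta>(2)[OF c(1)] \<eta>(2)[OF c(1)] eq[OF c(2)] Suc.IH[OF c(3)] by simp
    then show ?case using \<theta>(1) \<eta>(1) conflationD(1,3)[OF c(1)] by simp
  qed
  then show ?thesis using resolution_exists[OF A] euler_of_resolution by blast
qed

lemma euler_characteristic_exists:
  obtains \<chi> where "\<And>A. A \<in> obj T \<Longrightarrow> \<chi> A \<in> carrier G"
    and "\<And>A B. (A, B) \<in> iso_rel T \<Longrightarrow> \<chi> A = \<chi> B"
    and "\<And>A f B g C. conflation T A f B g C \<Longrightarrow> \<chi> B = \<chi> A \<otimes>\<^bsub>G\<^esub> \<chi> C"
    and "\<And>A n Xs d. finite_resolution T \<S> A n Xs d \<Longrightarrow> A \<in> obj T \<Longrightarrow>
      \<chi> A = (\<Otimes>\<^bsub>G\<^esub>i\<in>{..n}. cls (Xs i) [^]\<^bsub>G\<^esub> ((- 1) ^ i :: int))"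
    and "\<And>A. A \<in> \<S> \<Longrightarrow> \<chi> A = cls A"
proof -
  define \<chi> where "\<chi> A = (SOME v. \<exists>n. euler n A v)" for A
  have \<chi>: "\<exists>n. euler n A (\<chi> A)" if "A \<in> obj T" for A
    unfolding \<chi>_def
    by (rule someI_ex) (use resolution_exists[OF that] euler_of_resolution in blast)
  have eq: "\<chi> A = v" if "A \<in> obj T" "euler n A v" for A n v
    using \<chi>[OF that(1)] euler_iso_unique[OF _ that(2)] that(1) iso_arr_ident
    unfolding iso_rel_def by blast
  show thesis
  proof (rule that)
    show "\<chi> A \<in> carrier G" if "A \<in> obj T" for A using \<chi>[OF that] euler_in by blast
    show "\<chi> A = \<chi> B" if "(A, B) \<in> iso_rel T" for A B
    proof -
      have "A \<in> obj T" "B \<in> obj T" using that by (auto simp: iso_rel_def)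
      then show ?thesis using \<chi> euler_iso_unique that by blast
    qed
    show "\<chi> B = \<chi> A \<otimes>\<^bsub>G\<^esub> \<chi> C" if cf: "conflation T A f B g C" for A f B g C
    proof -
      obtain l m n where "euler l A (\<chi> A)" "euler m B (\<chi> B)" "euler n C (\<chi> C)"
        using \<chi>[OF conflationD(1)[OF cf]] \<chi>[OF conflationD(2)[OF cf]] \<chi>[OF conflationD(3)[OF cf]]
        by (elim exE)
      then have "euler (l + m + n) A (\<chi> A)" "euler (l + m + n) B (\<chi> B)" "euler (l + m + n) C (\<chi> C)"
          using euler_raise[of l A _ "l + m + n"] euler_raise[of m B _ "l + m + n"]
          euler_raise[of n C _ "l + m + n"] by simp_all
      then show ?thesis using euler_conflation[OF cf] by blast
    qed
    show "\<chi> A = (\<Otimes>\<^bsub>G\<^esub>i\<in>{..n}. cls (Xs i) [^]\<^bsub>G\<^esub> ((- 1) ^ i :: int))"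
      if "finite_resolution T \<S> A n Xs d" "A \<in> obj T" for A n Xs d
      using eq[OF that(2) euler_of_resolution[OF that(1)]] .
    show "\<chi> A = cls A" if "A \<in> \<S>" for A using eq[of A 0] sub_obj that by simp
  qed
qed

end

section \<open>The universal property of the Grothendieck group\<close>

lemma K0_gen_in_free:
  assumes "A \<in> obj T"
  shows "K0_gen T A \<in> carrier (K0_free T)"
  using assms by (auto simp: K0_gen_def K0_free_def intro: quotientI)

lemma K0_relation_in_free:
  assumes "A \<in> obj T" "B \<in> obj T" "C \<in> obj T"
  shows "K0_gen T A - K0_gen T B + K0_gen T C \<in> carrier (K0_free T)"
proof -
  interpret F: comm_group "K0_free T"
    unfolding K0_free_def by (rule abelian_free_Abelian_group)
  have "K0_gen T A \<otimes>\<^bsub>K0_free T\<^esub> inv\<^bsub>K0_free T\<^esub> K0_gen T B \<otimes>\<^bsub>K0_free T\<^esub> K0_gen T C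
      \<in> carrier (K0_free T)"
    using assms by (simp only: F.m_closed F.inv_closed K0_gen_in_free)
  then show ?thesis
    using K0_gen_in_free[OF assms(2)] by (simp add: K0_free_def)
qed

lemma conflation_objects:
  assumes "conflation T A f B g C"
  shows "A \<in> obj T" "B \<in> obj T" "C \<in> obj T"
  using assms by (auto simp: conflation_def realizes_def sequences_def)

lemma K0_relations_normal: "K0_relations T \<lhd> K0_free T"
proof -
  interpret F: comm_group "K0_free T"
    unfolding K0_free_def by (rule abelian_free_Abelian_group)
  show ?thesis
    unfolding K0_relations_def
    by (intro F.subgroup_imp_normal F.generate_is_subgroup)
      (auto intro!: K0_relation_in_free dest: conflation_objects)
qed

lemma K0_projection_hom: "(\<lambda>x. K0_relations T #>\<^bsub>K0_free T\<^esub> x) \<in> hom (K0_free T) (K0 T)"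
  unfolding K0_def by (rule normal.r_coset_hom_Mod[OF K0_relations_normal])

lemma K0_class_in: "A \<in> obj T \<Longrightarrow> K0_class T A \<in> carrier (K0 T)"
  unfolding K0_class_def by (rule hom_in_carrier[OF K0_projection_hom K0_gen_in_free])

lemma K0_class_iso:
  assumes "preadditive_category T" "(A, B) \<in> iso_rel T"
  shows "K0_class T A = K0_class T B"
  using equiv_class_eq[OF preadditive_category.equiv_iso_rel[OF assms(1)] assms(2)]
  by (simp add: K0_class_def K0_gen_def)

text \<open>
  The generator of \<open>B\<close> is moved to the other side, so that no inverse in \<open>H\<close> has to be handled.
\<close>

lemma hom_K0_free_relation:
  assumes h: "h \<in> hom (K0_free T) H" and A: "A \<in> obj T" and B: "B \<in> obj T" and C: "C \<in> obj T"
  shows "h (K0_gen T A - K0_gen T B + K0_gen T C) \<otimes>\<^bsub>H\<^esub> h (K0_gen T B)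
    = h (K0_gen T A) \<otimes>\<^bsub>H\<^esub> h (K0_gen T C)"
  using hom_mult[OF h K0_relation_in_free[OF A B C] K0_gen_in_free[OF B]]
    hom_mult[OF h K0_gen_in_free[OF A] K0_gen_in_free[OF C]]
  by (simp add: K0_free_def)

lemma K0_class_conflation:
  assumes c: "conflation T A f B g C"
  shows "K0_class T B = K0_class T A \<otimes>\<^bsub>K0 T\<^esub> K0_class T C"
proof -
  interpret K: comm_group "K0 T" by (rule comm_group_K0)
  interpret N: normal "K0_relations T" "K0_free T" by (rule K0_relations_normal)
  let ?r = "K0_gen T A - K0_gen T B + K0_gen T C"
  have "?r \<in> K0_relations T"
    unfolding K0_relations_def by (rule generate.incl) (use c in blast)
  then have "K0_relations T #>\<^bsub>K0_free T\<^esub> ?r = \<one>\<^bsub>K0 T\<^esub>"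
    unfolding K0_def by (simp add: N.rcos_const)
  then show ?thesis
    using hom_K0_free_relation[OF K0_projection_hom[of T] conflation_objects[OF c]]
      K0_class_in[OF conflation_objects(2)[OF c]]
    by (simp add: K0_class_def)
qed

lemma K0_universal:
  assumes T: "preadditive_category T" and G: "comm_group G"
    and \<chi>: "\<And>A. A \<in> obj T \<Longrightarrow> \<chi> A \<in> carrier G"
    and iso: "\<And>A B. (A, B) \<in> iso_rel T \<Longrightarrow> \<chi> A = \<chi> B"
    and conf: "\<And>A f B g C. conflation T A f B g C \<Longrightarrow> \<chi> B = \<chi> A \<otimes>\<^bsub>G\<^esub> \<chi> C"
  shows "\<exists>h\<in>hom (K0 T) G. \<forall>A\<in>obj T. h (K0_class T A) = \<chi> A"
proof -
  interpret G: comm_group G by (rule G)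
  interpret F: comm_group "K0_free T"
    unfolding K0_free_def by (rule abelian_free_Abelian_group)
  note eq = preadditive_category.equiv_iso_rel[OF T]
  \<comment> \<open>The basis consists of isomorphism classes, so \<open>\<chi>\<close> is evaluated at chosen representatives.\<close>
  let ?\<rho> = "\<lambda>X. \<chi> (SOME A. A \<in> X)"
  have \<rho>: "?\<rho> (iso_rel T `` {A}) = \<chi> A" if "A \<in> obj T" for A
  proof -
    have "(SOME B. B \<in> iso_rel T `` {A}) \<in> iso_rel T `` {A}"
      by (rule someI) (rule equiv_class_self[OF eq that])
    then show ?thesis using iso by simp
  qed
  have "?\<rho> ` (obj T // iso_rel T) \<subseteq> carrier G"
    using \<rho> \<chi> by (auto elim!: quotientE)
  then obtain k where k: "k \<in> hom (K0_free T) G" "\<And>X. X \<in> obj T // iso_rel T \<Longrightarrow> k (frag_of X) = ?\<rho> X"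
    unfolding K0_free_def using G.free_Abelian_group_universal by blast
  have k_gen: "k (K0_gen T A) = \<chi> A" if "A \<in> obj T" for A
    using k(2)[OF quotientI[OF that]] \<rho>[OF that] by (simp add: K0_gen_def)
  interpret k: group_hom "K0_free T" G k by unfold_locales (rule k(1))
  have "K0_relations T \<subseteq> kernel (K0_free T) G k"
    unfolding K0_relations_def
  proof (rule F.generate_subgroup_incl[OF _ k.subgroup_kernel], clarify)
    fix A f B g C assume c: "conflation T A f B g C"
    note o = conflation_objects[OF c]
    let ?r = "K0_gen T A - K0_gen T B + K0_gen T C"
    have r: "?r \<in> carrier (K0_free T)" by (rule K0_relation_in_free[OF o])
    have "k ?r \<otimes>\<^bsub>G\<^esub> \<chi> B = \<chi> B"
      using hom_K0_free_relation[OF k(1) o] k_gen o conf[OF c] by simp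
    then have "k ?r = \<one>\<^bsub>G\<^esub>" using \<chi> o k.hom_closed[OF r] by (simp add: G.r_cancel_one)
    then show "?r \<in> kernel (K0_free T) G k" using r by (simp add: kernel_def)
  qed
  from k.FactGroup_universal_kernel[OF K0_relations_normal this]
  obtain h where "h \<in> hom (K0 T) G"
    "\<And>x. x \<in> carrier (K0_free T) \<Longrightarrow> h (K0_relations T #>\<^bsub>K0_free T\<^esub> x) = k x"
    unfolding K0_def by blast
  then show ?thesis using k_gen K0_gen_in_free by (metis K0_class_def)
qed

text \<open>
  The Grothendieck group is generated by the classes of objects.
\<close>

lemma K0_hom_ext:
  assumes H: "group H" and h: "h \<in> hom (K0 T) H" and h': "h' \<in> hom (K0 T) H"
    and eq: "\<And>A. A \<in> obj T \<Longrightarrow> h (K0_class T A) = h' (K0_class T A)"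
    and x: "x \<in> carrier (K0 T)"
  shows "h x = h' x"
proof -
  interpret H: group H by (rule H)
  interpret F: comm_group "K0_free T"
    unfolding K0_free_def by (rule abelian_free_Abelian_group)
  let ?q = "\<lambda>x. K0_relations T #>\<^bsub>K0_free T\<^esub> x"
  obtain y where y: "y \<in> carrier (K0_free T)" "x = ?q y"
    using x unfolding K0_def carrier_FactGroup by blast
  have hq: "h \<circ> ?q \<in> hom (K0_free T) H" and hq': "h' \<circ> ?q \<in> hom (K0_free T) H"
    using hom_compose[OF K0_projection_hom] h h' by blast+
  interpret hq: group_hom "K0_free T" H "h \<circ> ?q"
    by unfold_locales (rule hq)
  interpret hq': group_hom "K0_free T" H "h' \<circ> ?q"
    by unfold_locales (rule hq')
  have "Poly_Mapping.keys y \<subseteq> obj T // iso_rel T" using y by (simp add: K0_free_def)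
  then have "(h \<circ> ?q) y = (h' \<circ> ?q) y"
  proof (induction rule: free_Abelian_group_induct[consumes 1, case_names zero diff gen])
    case zero
    show ?case using hq.hom_one hq'.hom_one by (simp add: K0_free_def)
  next
    case (diff a b)
    then have ab: "a \<in> carrier (K0_free T)" "b \<in> carrier (K0_free T)" "a - b = a \<otimes>\<^bsub>K0_free T\<^esub> inv\<^bsub>K0_free T\<^esub> b"
      by (simp_all add: K0_free_def)
    then show ?case using diff.IH by (simp del: o_apply)
  next
    case (gen X)
    then obtain A where "A \<in> obj T" "X = iso_rel T `` {A}" by (auto elim: quotientE)
    then show ?case using eq[of A] by (simp add: K0_class_def K0_gen_def)
  qed
  then show ?thesis using y by simp
qed

section \<open>Extension-closed subcategories\<close>

lemma full_sub_simps [simp]: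
  "obj (full_sub T \<S>) = \<S>" "hom_group (full_sub T \<S>) = hom_group T" "Hom (full_sub T \<S>) = Hom T"
  "ident (full_sub T \<S>) = ident T" "comp_arr (full_sub T \<S>) = comp_arr T"
  "ext_group (full_sub T \<S>) = ext_group T" "Ext (full_sub T \<S>) = Ext T"
  "iso_arr (full_sub T \<S>) = iso_arr T"
  by (auto simp: full_sub_def Hom_def Ext_def iso_arr_def fun_eq_iff)

lemma iso_rel_full_sub: "\<S> \<subseteq> obj T \<Longrightarrow> iso_rel (full_sub T \<S>) \<subseteq> iso_rel T"
  by (auto simp: iso_rel_def)

lemma seq_rel_full_sub:
  assumes "\<S> \<subseteq> obj T" "B \<in> \<S>"
  shows "seq_rel (full_sub T \<S>) A C `` {(B, f, g)} = {(B', f', g') \<in> seq_rel T A C `` {(B, f, g)}. B' \<in> \<S>}"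
  using assms by (auto simp: seq_rel_def sequences_def)

text \<open>
  The restricted realization is the part of the original class whose middle terms lie in \<open>\<S>\<close>.  When
  \<open>B\<close> is in \<open>\<S>\<close>, this part determines the class, since it contains the sequence with middle term \<open>B\<close>.
\<close>

lemma (in extriangulated) conflation_full_sub:
  assumes sub: "\<S> \<subseteq> obj T"
  shows "conflation (full_sub T \<S>) A f B g C \<longleftrightarrow>
    conflation T A f B g C \<and> A \<in> \<S> \<and> B \<in> \<S> \<and> C \<in> \<S>"
proof
  assume "conflation (full_sub T \<S>) A f B g C"
  then obtain \<delta> where \<delta>: "A \<in> \<S>" "C \<in> \<S>" "B \<in> \<S>" "\<delta> \<in> Ext T C A" "f \<in> Hom T A B" "g \<in> Hom T B C"
    and eq: "realization (full_sub T \<S>) C A \<delta> = seq_rel (full_sub T \<S>) A C `` {(B, f, g)}"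
    by (auto simp: conflation_def realizes_def sequences_def)
  have o: "A \<in> obj T" "B \<in> obj T" "C \<in> obj T" using \<delta> sub by auto
  then have s: "(B, f, g) \<in> sequences T A C" using \<delta> by (simp add: sequences_def)
  then have "(B, f, g) \<in> seq_rel (full_sub T \<S>) A C `` {(B, f, g)}"
    unfolding seq_rel_full_sub[OF sub \<delta>(3)]
    using equiv_class_self[OF equiv_seq_rel[OF o(1,3)] s] \<delta>(3) by simp
  then have in_real: "(B, f, g) \<in> realization T C A \<delta>"
    unfolding eq[symmetric] by (auto simp: full_sub_def)
  obtain B' f' g' where r: "realizes T C A \<delta> B' f' g'" using realizes_exists[OF o(1,3) \<delta>(4)] .
  then have "((B', f', g'), (B, f, g)) \<in> seq_rel T A C" using in_real by (auto simp: realizes_def)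
  then show "conflation T A f B g C \<and> A \<in> \<S> \<and> B \<in> \<S> \<and> C \<in> \<S>"
    using realizes_transport[OF r] \<delta> unfolding conflation_def by blast
next
  assume *: "conflation T A f B g C \<and> A \<in> \<S> \<and> B \<in> \<S> \<and> C \<in> \<S>"
  then obtain \<delta> where r: "realizes T C A \<delta> B f g" by (auto simp: conflation_def)
  have "realization (full_sub T \<S>) C A \<delta> = seq_rel (full_sub T \<S>) A C `` {(B, f, g)}"
    using r * seq_rel_full_sub[OF sub, of B] by (auto simp: full_sub_def realizes_def)
  then have "realizes (full_sub T \<S>) C A \<delta> B f g"
    using r * by (auto simp: realizes_def sequences_def)
  then show "conflation (full_sub T \<S>) A f B g C" unfolding conflation_def by blast
qed

section \<open>The resolution theorem\<close>

theorem theoremA: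
  fixes T :: "('o, 'm, 'e) extri_data" and \<S> :: "'o set"
  assumes "extriangulated T"
    and "extension_closed T \<S>"
    and "cocone_closed T \<S>"
    and "\<And>A. A \<in> obj T \<Longrightarrow> \<exists>n Xs d. finite_resolution T \<S> A n Xs d"
  shows "\<exists>\<phi> \<psi>. group_isomorphisms (K0 T) (K0 (full_sub T \<S>)) \<phi> \<psi> \<and>
    (\<forall>A\<in>obj T. \<forall>n Xs d. finite_resolution T \<S> A n Xs d \<longrightarrow>
       \<phi> (K0_class T A) =
         (\<Otimes>\<^bsub>K0 (full_sub T \<S>)\<^esub>i\<in>{..n}.
            K0_class (full_sub T \<S>) (Xs i) [^]\<^bsub>K0 (full_sub T \<S>)\<^esub> ((- 1) ^ i :: int))) \<and>
    (\<forall>A\<in>\<S>. \<psi> (K0_class (full_sub T \<S>) A) = K0_class T A)"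
proof -
  let ?X = "full_sub T \<S>"
  interpret extriangulated T by (rule assms(1))
  interpret K: comm_group "K0 T" by (rule comm_group_K0)
  interpret KX: comm_group "K0 ?X" by (rule comm_group_K0)
  have pre: "preadditive_category T" by unfold_locales
  have sub: "\<S> \<subseteq> obj T" and "additive_category ?X"
    using assms(2) unfolding extension_closed_def by blast+
  then have preX: "preadditive_category ?X" by (simp add: additive_category_def)
  note cX = conflation_full_sub[OF sub]
  interpret additive_on_resolving T \<S> "K0 ?X" "K0_class ?X"
    by unfold_locales (use assms K0_class_in[of _ ?X] K0_class_conflation[of ?X] cX in auto)
  obtain \<chi> where \<chi>: "\<And>A. A \<in> obj T \<Longrightarrow> \<chi> A \<in> carrier (K0 ?X)"
    "\<And>A B. (A, B) \<in> iso_rel T \<Longrightarrow> \<chi> A = \<chi> B"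
    "\<And>A f B g C. conflation T A f B g C \<Longrightarrow> \<chi> B = \<chi> A \<otimes>\<^bsub>K0 ?X\<^esub> \<chi> C"
    "\<And>A n Xs d. finite_resolution T \<S> A n Xs d \<Longrightarrow> A \<in> obj T \<Longrightarrow>
      \<chi> A = (\<Otimes>\<^bsub>K0 ?X\<^esub>i\<in>{..n}. K0_class ?X (Xs i) [^]\<^bsub>K0 ?X\<^esub> ((- 1) ^ i :: int))"
    "\<And>A. A \<in> \<S> \<Longrightarrow> \<chi> A = K0_class ?X A"
    by (rule euler_characteristic_exists) (rule that)
  have "\<exists>\<phi>\<in>hom (K0 T) (K0 ?X). \<forall>A\<in>obj T. \<phi> (K0_class T A) = \<chi> A"
    by (rule K0_universal[OF pre KX.comm_group_axioms]) (erule \<chi>(1-3))+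
  then obtain \<phi> where \<phi>: "\<phi> \<in> hom (K0 T) (K0 ?X)" "\<And>A. A \<in> obj T \<Longrightarrow> \<phi> (K0_class T A) = \<chi> A"
    by blast
  have "\<exists>\<psi>\<in>hom (K0 ?X) (K0 T). \<forall>A\<in>obj ?X. \<psi> (K0_class ?X A) = K0_class T A"
  proof (rule K0_universal[OF preX K.comm_group_axioms])
    show "K0_class T A \<in> carrier (K0 T)" if "A \<in> obj ?X" for A
      by (intro K0_class_in) (use that sub in auto)
    show "K0_class T A = K0_class T B" if "(A, B) \<in> iso_rel ?X" for A B
      using that iso_rel_full_sub[OF sub] K0_class_iso[OF pre] by blast
    show "K0_class T B = K0_class T A \<otimes>\<^bsub>K0 T\<^esub> K0_class T C" if "conflation ?X A f B g C" for A f B g C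
      using K0_class_conflation[of T] that unfolding cX by blast
  qed
  then obtain \<psi> where \<psi>: "\<psi> \<in> hom (K0 ?X) (K0 T)"
    "\<And>A. A \<in> \<S> \<Longrightarrow> \<psi> (K0_class ?X A) = K0_class T A" by auto
  interpret \<psi>: group_hom "K0 ?X" "K0 T" \<psi> by unfold_locales (rule \<psi>(1))
  have \<phi>\<psi>: "\<phi> (\<psi> y) = y" if "y \<in> carrier (K0 ?X)" for y
  proof -
    have "(\<phi> \<circ> \<psi>) y = id y"
      by (rule K0_hom_ext[OF KX.group_axioms hom_compose[OF \<psi>(1) \<phi>(1)] _ _ that])
        (use \<phi>(2) \<psi>(2) \<chi>(5) sub in \<open>auto simp: hom_def\<close>)
    then show ?thesis by simp
  qed
  \<comment> \<open>Both sides are additive in \<open>A\<close> on the whole category and agree on \<open>\<S>\<close>.\<close>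
  have \<psi>_euler: "\<psi> (\<phi> (K0_class T A)) = K0_class T A" if A: "A \<in> obj T" for A
  proof -
    have "\<psi> (\<chi> A) = K0_class T A"
    proof (rule additive_unique[OF K.group_axioms _ _ _ _ _ A])
      show "\<psi> (\<chi> B) \<in> carrier (K0 T)" if "B \<in> obj T" for B
        using \<psi>.hom_closed[OF \<chi>(1)[OF that]] .
      show "\<psi> (\<chi> B) = \<psi> (\<chi> A) \<otimes>\<^bsub>K0 T\<^esub> \<psi> (\<chi> D)" if c: "conflation T A f B g D" for A f B g D
        unfolding \<chi>(3)[OF c] using \<psi>.hom_mult[OF \<chi>(1) \<chi>(1)] conflation_objects[OF c] by blast
      show "\<psi> (\<chi> B) = K0_class T B" if "B \<in> \<S>" for B
        using \<chi>(5)[OF that] \<psi>(2)[OF that] by simp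
    qed (fact K0_class_in K0_class_conflation)+
    then show ?thesis using \<phi>(2)[OF A] by simp
  qed
  have "\<psi> (\<phi> x) = x" if "x \<in> carrier (K0 T)" for x
  proof -
    have "(\<psi> \<circ> \<phi>) x = id x"
      by (rule K0_hom_ext[OF K.group_axioms hom_compose[OF \<phi>(1) \<psi>(1)] _ _ that])
        (use \<psi>_euler in \<open>auto simp: hom_def\<close>)
    then show ?thesis by simp
  qed
  then have "group_isomorphisms (K0 T) (K0 ?X) \<phi> \<psi>"
    using \<phi>(1) \<psi>(1) \<phi>\<psi> unfolding group_isomorphisms_def by blast
  then show ?thesis using \<phi>(2) \<psi>(2) \<chi>(4) by (intro exI conjI ballI allI impI) auto
qed

end
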